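(* For $\gamma\in\mathbb R$ let $$\xi(\gamma):=-\lim_{\alpha\to\infty}\frac{\alpha}{\log|C(\alpha,\gamma)|},$$ where $C(\alpha,\gamma)=E_1^\gamma(\alpha)^2-E_2^\gamma(\alpha)^2$ for $\gamma\neq1$ and $C(\alpha,1)=0$ for all $\alpha\ge0$. Then $$\xi(\gamma)=\begin{cases}\dfrac{1}{2e_2(\gamma)}&\gamma<-1,\\[4pt] \infty&\gamma=-1,\\ \dfrac1{2e_2(\gamma)}&-1<\gamma<1,\\[4pt] 0&\gamma=1,\\ \dfrac14&\gamma>1.\end{cases}$$
   Context: $e_1(\gamma)=2+\sqrt{2(1-\gamma)}$; $e_2(\gamma)=2-\sqrt{2(1-\gamma)}$ for $\gamma>-1$, $e_2(\gamma)=-2+\sqrt{2(1-\gamma)}$ for $\gamma<-1$, $e_2(-1)=0$ (for $\gamma>1$, $e_2(\gamma)=\overline{e_1(\gamma)}$). With $R_\gamma(p)=\sqrt{-4-8\gamma-4\gamma^2+12p^2-4\gamma p^2-p^4}$, for $\gamma\ne1$ and $\alpha>0$, $$E_1^\gamma(\alpha)=\frac1\pi\int_{e_2(\gamma)}^{e_1(\gamma)}\frac{2p\,e^{-\alpha p}}{R_\gamma(p)}\,dp,\qquad E_2^\gamma(\alpha)=\frac1\pi\int_{e_2(\gamma)}^{e_1(\gamma)}\frac{(-2-2\gamma-p^2)\,e^{-\alpha p}}{2R_\gamma(p)}\,dp.$$ For $\gamma<1$ the integrals are over a real interval and $R_\gamma\ge0$. For $\gamma>1$, with $r=\sqrt{2(\gamma-1)}$,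 they are along the segment $p=2+is$, $-r\le s\le r$, with $R_\gamma(2+is)=i\sqrt{r^2-s^2}\sqrt{(4+is)^2+r^2}$ (principal square roots). The convention $\alpha/\log 0=0$ is used. ($C(\alpha,\gamma)$ is the covariance of two particles at distance $\alpha$ in the scaling limit of a particle model and $\xi$ its correlation length.)
   Formalization: For γ>1 the limit defining ξ does not exist, since C(α,γ) has zeros at arbitrarily large α (where α/log 0 = 0), so ξ(γ) is taken as the upper limit of −α/log|C(α,γ)|; for γ≤1 the ordinary limit is proved as stated. *)

theory Defs
  imports "HOL-Complex_Analysis.Complex_Analysis"
begin

text \<open>
  The endpoints are complex numbers, so that one definition covers all \<open>\<gamma>\<close>: they are real for
  \<open>\<gamma> \<le> 1\<close>, and for \<open>\<gamma> > 1\<close> the principal root gives \<open>e1 \<gamma> = 2 + i r\<close> and \<open>e2 \<gamma> = 2 - i r\<close> with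
  \<open>r = sqrt (2 (\<gamma> - 1))\<close>.
\<close>

definition e1 :: "real \<Rightarrow> complex" where
  "e1 \<gamma> = 2 + csqrt (of_real (2 * (1 - \<gamma>)))"

definition e2 :: "real \<Rightarrow> complex" where
  "e2 \<gamma> = (if \<gamma> > -1 then 2 - csqrt (of_real (2 * (1 - \<gamma>)))
           else if \<gamma> < -1 then -2 + csqrt (of_real (2 * (1 - \<gamma>)))
           else 0)"

text \<open>
  For \<open>\<gamma> > 1\<close> the branch of the square root is fixed only on the segment \<open>p = 2 + i s\<close>,
  \<open>-r \<le> s \<le> r\<close>, where \<open>s = Im p\<close> and \<open>4 + i s = p + 2\<close>.  It is not the principal root of the
  polynomial: the two differ in sign on half of the segment.
\<close>

definition Rfun :: "real \<Rightarrow> complex \<Rightarrow> complex" where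
  "Rfun \<gamma> p =
    (if \<gamma> < 1
     then csqrt (-4 - 8 * of_real \<gamma> - 4 * of_real \<gamma> ^ 2 + 12 * p ^ 2
                 - 4 * of_real \<gamma> * p ^ 2 - p ^ 4)
     else let r = sqrt (2 * (\<gamma> - 1))
          in \<i> * of_real (sqrt (r ^ 2 - Im p ^ 2)) * csqrt ((p + 2) ^ 2 + of_real (r ^ 2)))"

definition E1 :: "real \<Rightarrow> real \<Rightarrow> complex" where
  "E1 \<gamma> \<alpha> = 1 / of_real pi *
     contour_integral (linepath (e2 \<gamma>) (e1 \<gamma>))
       (\<lambda>p. 2 * p * exp (- of_real \<alpha> * p) / Rfun \<gamma> p)"

definition E2 :: "real \<Rightarrow> real \<Rightarrow> complex" where
  "E2 \<gamma> \<alpha> = 1 / of_real pi *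
     contour_integral (linepath (e2 \<gamma>) (e1 \<gamma>))
       (\<lambda>p. (-2 - 2 * of_real \<gamma> - p ^ 2) * exp (- of_real \<alpha> * p) / (2 * Rfun \<gamma> p))"

definition cov :: "real \<Rightarrow> real \<Rightarrow> complex" where
  "cov \<alpha> \<gamma> = (if \<gamma> = 1 then 0 else E1 \<gamma> \<alpha> ^ 2 - E2 \<gamma> \<alpha> ^ 2)"

text \<open>
  The convention \<open>\<alpha> / log 0 = 0\<close> holds because \<open>ln 0 = 0\<close> and \<open>x / 0 = 0\<close>.
\<close>

definition local_corr_length :: "real \<Rightarrow> real \<Rightarrow> real" where
  "local_corr_length \<gamma> \<alpha> = - (\<alpha> / ln (cmod (cov \<alpha> \<gamma>)))"

text \<open>
  The upper limit is used because for \<open>\<gamma> > 1\<close> the covariance is \<open>exp (-4 \<alpha>)\<close> times an oscillating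
  function with arbitrarily large zeros, at which \<open>local_corr_length\<close> is 0; so there is no limit
  in the ordinary sense.
\<close>

definition corr_length :: "real \<Rightarrow> ereal" where
  "corr_length \<gamma> = Limsup at_top (\<lambda>\<alpha>. ereal (local_corr_length \<gamma> \<alpha>))"

lemma e1_real: "\<gamma> \<le> 1 \<Longrightarrow> e1 \<gamma> = of_real (2 + sqrt (2 * (1 - \<gamma>)))"
  by (simp add: e1_def)

lemma e2_real:
  assumes "\<gamma> \<le> 1"
  shows "e2 \<gamma> = of_real (if \<gamma> > -1 then 2 - sqrt (2 * (1 - \<gamma>))
                        else if \<gamma> < -1 then -2 + sqrt (2 * (1 - \<gamma>)) else 0)"
  using assms by (simp add: e2_def)

lemma e2_cnj:
  assumes "\<gamma> > 1"
  shows "e2 \<gamma> = cnj (e1 \<gamma>)" and "e1 \<gamma> = 2 + \<i> * of_real (sqrt (2 * (\<gamma> - 1)))"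
  using assms by (auto simp: e1_def e2_def complex_eq_iff real_sqrt_divide)

lemma Rfun_segment:
  assumes "\<gamma> > 1"
  shows "Rfun \<gamma> (2 + \<i> * of_real s) =
    \<i> * of_real (sqrt (sqrt (2 * (\<gamma> - 1)) ^ 2 - s ^ 2)) *
      csqrt ((4 + \<i> * of_real s) ^ 2 + of_real (sqrt (2 * (\<gamma> - 1)) ^ 2))"
proof -
  have "2 + \<i> * of_real s + 2 = 4 + \<i> * of_real s" by simp
  then show ?thesis using assms unfolding Rfun_def Let_def by simp
qed

lemma Rfun_real:
  assumes "\<gamma> < 1" and "-4 - 8 * \<gamma> - 4 * \<gamma> ^ 2 + 12 * p ^ 2 - 4 * \<gamma> * p ^ 2 - p ^ 4 \<ge> 0"
  shows "Rfun \<gamma> (of_real p) =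
    of_real (sqrt (-4 - 8 * \<gamma> - 4 * \<gamma> ^ 2 + 12 * p ^ 2 - 4 * \<gamma> * p ^ 2 - p ^ 4))"
proof -
  have "(-4 - 8 * of_real \<gamma> - 4 * of_real \<gamma> ^ 2 + 12 * of_real p ^ 2
           - 4 * of_real \<gamma> * of_real p ^ 2 - of_real p ^ 4 :: complex)
        = of_real (-4 - 8 * \<gamma> - 4 * \<gamma> ^ 2 + 12 * p ^ 2 - 4 * \<gamma> * p ^ 2 - p ^ 4)"
    by simp
  then show ?thesis
    using assms by (simp only: Rfun_def if_True of_real_sqrt)
qed

end

theory Submission
  imports Defs
begin

text \<open>
  Write \<open>\<kappa> = 2 + 2 \<gamma>\<close>. The radicand of \<open>Rfun\<close> factors as \<open>v w\<close> with
  \<open>v = 4 p - p\<^sup>2 - \<kappa>\<close> and \<open>w = 4 p + p\<^sup>2 + \<kappa>\<close>, and these two factors are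
  also the numerators of the sum and the difference of the two integrals:
  \<open>E1 + E2\<close> integrates \<open>v / R\<close> and \<open>E1 - E2\<close> integrates \<open>w / R\<close>, both against
  \<open>exp (-\<alpha> p) / (2 \<pi>)\<close>. The covariance is the product of these two integrals. The substitution
  \<open>p = (e2 + e1)/2 - (e1 - e2)/2 \<cdot> cos \<theta>\<close> absorbs the inverse square root singularities at both
  endpoints (\<open>contour_integral_chord\<close>), so that only continuous integrands on \<open>[0, \<pi>]\<close> are left.

  For \<open>\<gamma> < 1\<close> both integrands are positive inside the interval (\<open>cov_below_1\<close>), so nothing
  cancels, and Laplace's principle says that each integral decays like \<open>exp (-\<alpha> e2)\<close> on the
  logarithmic scale. Hence \<open>ln (cov) / \<alpha> \<longlongrightarrow> -2 e2\<close>, which gives \<open>1 / (2 e2)\<close>. At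
  \<open>\<gamma> = -1\<close> the rate is 0; there the covariance still tends to 0, so its logarithm is eventually
  negative and the length tends to \<open>+\<infinity>\<close>.

  For \<open>\<gamma> > 1\<close> the segment is vertical with real part 2, so the covariance is \<open>exp (-4 \<alpha>)\<close> times
  a bounded oscillating factor \<open>F \<alpha> = \<integral>\<integral> \<Phi> exp (-i \<alpha> \<psi>)\<close> with a real phase \<open>\<psi>\<close>. This gives
  the upper bound \<open>1/4\<close>. The upper limit is smaller only if \<open>F\<close> decays exponentially. A
  complex-analytic argument excludes that: if the samples \<open>F (n \<tau>)\<close> decay geometrically,
  then their generating function \<open>w \<mapsto> \<integral>\<integral> \<Phi> / (1 - w exp (-i \<tau> \<psi>))\<close>, which is holomorphic off an
  arc of the unit circle and vanishes at infinity, continues across the arc. By Liouville's theorem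
  it is 0, and its value \<open>\<integral>\<integral> \<Phi>\<close> at \<open>w = 0\<close> vanishes
  (\<open>integral_eq_0_if_moments_decay\<close>). But that value is the product of two integrals over
  functions with positive real part.
\<close>

section \<open>Oscillatory integrals do not decay exponentially\<close>

text \<open>
  The generating function \<open>G w = \<integral> \<Phi> / (1 - w u)\<close> of the moments is holomorphic wherever \<open>w u\<close>
  avoids 1, in particular for \<open>norm w \<noteq> 1\<close> and on the left half-plane, since \<open>u\<close> takes values in the
  open right half of the unit circle. Geometric decay of the moments makes their power series \<open>P\<close>
  converge on a disc of radius \<open>R > 1\<close>. The inner disc and the outer region are connected through the
  left half-plane, so \<open>P\<close> and \<open>G\<close> agree there and glue to an entire function vanishing at infinity.
\<close>

lemma integral_eq_0_if_moments_decay: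
  fixes \<Phi> u :: "'a::euclidean_space \<Rightarrow> complex"
  assumes cont: "continuous_on (cbox a b) \<Phi>" "continuous_on (cbox a b) u"
    and unit: "\<And>x. x \<in> cbox a b \<Longrightarrow> norm (u x) = 1"
    and right: "\<And>x. x \<in> cbox a b \<Longrightarrow> Re (u x) > 0"
    and q: "0 < q" "q < 1"
    and decay: "\<forall>\<^sub>F n in sequentially. norm (integral (cbox a b) (\<lambda>x. \<Phi> x * u x ^ n)) \<le> C * q ^ n"
  shows "integral (cbox a b) \<Phi> = 0"
proof -
  let ?X = "cbox a b"
  define c where "c n = integral ?X (\<lambda>x. \<Phi> x * u x ^ n)" for n
  define G where "G w = integral ?X (\<lambda>x. \<Phi> x / (1 - w * u x))" for w
  define P where "P w = (\<Sum>n. c n * w ^ n)" for w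
  define D where "D = {w::complex. norm w < 1} \<union> {w. norm w > 1} \<union> {w. Re w < 0}"
  have openD: "open D"
    unfolding D_def by (intro open_Un open_Collect_less continuous_intros)
  have nz: "1 - w * u x \<noteq> 0" if "w \<in> D" "x \<in> ?X" for w x
  proof
    assume "1 - w * u x = 0"
    then have eq: "w * u x = 1" by simp
    then have "norm w = 1"
      using unit[OF that(2)] by (metis mult_cancel_left1 mult.right_neutral norm_mult norm_one)
    moreover have "w = cnj (u x)"
    proof -
      have "u x * cnj (u x) = 1" using unit[OF that(2)] by (simp add: complex_norm_square [symmetric])
      then have "w = w * (u x * cnj (u x))" by simp
      also have "\<dots> = cnj (u x)" using eq by (simp flip: mult.assoc)
      finally show ?thesis .
    qed
    ultimately show False using that right[OF that(2)] by (auto simp: D_def)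
  qed
  \<comment> \<open>\<open>D\<close> is not convex, so differentiation under the integral is done on small balls.\<close>
  have holG: "G holomorphic_on D"
    unfolding holomorphic_on_open[OF openD]
  proof
    fix w assume "w \<in> D"
    then obtain e where e: "e > 0" "ball w e \<subseteq> D" using openD by (meson openE)
    have "G holomorphic_on ball w e"
      unfolding G_def
    proof (rule leibniz_rule_holomorphic)
      fix z x assume "z \<in> ball w e" "x \<in> ?X"
      with e nz have "1 - z * u x \<noteq> 0" by blast
      then show "((\<lambda>z. \<Phi> x / (1 - z * u x)) has_field_derivative \<Phi> x * u x / (1 - z * u x)\<^sup>2)
          (at z within ball w e)"
        by (auto intro!: derivative_eq_intros simp: power2_eq_square)
    next
      fix z assume "z \<in> ball w e"
      with e nz show "(\<lambda>x. \<Phi> x / (1 - z * u x)) integrable_on ?X"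
        by (intro integrable_continuous continuous_intros cont) blast
    next
      have "(1 - fst z * u (snd z)) \<noteq> 0" if "z \<in> ball w e \<times> ?X" for z
        using that e nz[of "fst z" "snd z"] by auto
      then show "continuous_on (ball w e \<times> ?X) (\<lambda>(z, x). \<Phi> x * u x / (1 - z * u x)\<^sup>2)"
        unfolding case_prod_unfold
        by (intro continuous_intros continuous_on_compose2[OF cont(1)] continuous_on_compose2[OF cont(2)])
           auto
    qed auto
    then show "\<exists>f'. (G has_field_derivative f') (at w)"
      using e(1) by (meson centre_in_ball holomorphic_derivI open_ball)
  qed
  obtain M where M: "\<And>x. x \<in> ?X \<Longrightarrow> norm (\<Phi> x) \<le> M"
    using compact_imp_bounded[OF compact_continuous_image[OF cont(1) compact_cbox]]
    unfolding bounded_iff by blast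
  define K where "K = \<bar>M\<bar> * measure lborel ?X"
  have bound: "norm (integral ?X (\<lambda>x. \<Phi> x * f x)) \<le> K * B"
    if "continuous_on ?X f" "\<And>x. x \<in> ?X \<Longrightarrow> norm (f x) \<le> B" "B \<ge> 0" for f B
  proof -
    have "norm (\<Phi> x * f x) \<le> \<bar>M\<bar> * B" if "x \<in> ?X" for x
      unfolding norm_mult using that M[OF that] \<open>\<And>x. x \<in> ?X \<Longrightarrow> norm (f x) \<le> B\<close>[OF that]
      by (intro mult_mono) auto
    then show ?thesis
      using integrable_bound[of "\<bar>M\<bar> * B" "\<lambda>x. \<Phi> x * f x" a b] that cont
      by (simp add: K_def mult_ac integrable_continuous continuous_on_mult)
  qed
  \<comment> \<open>A truncated geometric series leaves an explicit remainder, so no limit is exchanged with the integral.\<close>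
  have Gsums: "(\<lambda>n. c n * w ^ n) sums G w" if "norm w < 1" for w
  proof -
    have D: "w \<in> D" using that by (simp add: D_def)
    have rem: "G w - (\<Sum>n<N. c n * w ^ n) = integral ?X (\<lambda>x. \<Phi> x * ((w * u x) ^ N / (1 - w * u x)))" for N
    proof -
      have "(\<Sum>n<N. c n * w ^ n) = integral ?X (\<lambda>x. \<Sum>n<N. \<Phi> x * (w * u x) ^ n)"
        unfolding c_def
        by (subst integral_sum)
           (auto intro!: integrable_continuous continuous_intros cont sum.cong
             simp: power_mult_distrib mult_ac simp flip: integral_mult_right)
      also have "G w - \<dots> = integral ?X (\<lambda>x. \<Phi> x / (1 - w * u x) - (\<Sum>n<N. \<Phi> x * (w * u x) ^ n))"
        unfolding G_def using nz[OF D]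
        by (intro integral_diff[symmetric] integrable_continuous continuous_intros cont) auto
      also have "\<dots> = integral ?X (\<lambda>x. \<Phi> x * ((w * u x) ^ N / (1 - w * u x)))"
      proof (rule integral_cong)
        fix x assume "x \<in> ?X"
        then have n: "1 - w * u x \<noteq> 0" using nz[OF D] by blast
        then have "w * u x \<noteq> 1" by auto
        then have "(\<Sum>n<N. (w * u x) ^ n) = (1 - (w * u x) ^ N) / (1 - w * u x)"
          by (simp add: sum_gp_strict)
        then have "\<Phi> x / (1 - w * u x) - (\<Sum>n<N. \<Phi> x * (w * u x) ^ n)
            = \<Phi> x * (1 / (1 - w * u x) - (1 - (w * u x) ^ N) / (1 - w * u x))"
          by (simp add: right_diff_distrib flip: sum_distrib_left)
        then show "\<Phi> x / (1 - w * u x) - (\<Sum>n<N. \<Phi> x * (w * u x) ^ n)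
            = \<Phi> x * ((w * u x) ^ N / (1 - w * u x))"
          by (simp flip: diff_divide_distrib)
      qed
      finally show ?thesis .
    qed
    have le: "norm (G w - (\<Sum>n<N. c n * w ^ n)) \<le> K * (norm w ^ N / (1 - norm w))" for N
      unfolding rem
    proof (rule bound)
      show "continuous_on ?X (\<lambda>x. (w * u x) ^ N / (1 - w * u x))"
        using nz[OF D] by (intro continuous_intros cont) auto
      fix x assume x: "x \<in> ?X"
      have "1 - norm w \<le> norm (1 - w * u x)"
        using norm_triangle_ineq2[of 1 "w * u x"] unit[OF x] by (simp add: norm_mult)
      then show "norm ((w * u x) ^ N / (1 - w * u x)) \<le> norm w ^ N / (1 - norm w)"
        using that unit[OF x]
        by (simp add: norm_divide norm_mult norm_power frac_le)
    qed (use that in auto)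
    have "(\<lambda>N. norm w ^ N) \<longlonglongrightarrow> 0"
      using that by (intro LIMSEQ_power_zero) simp
    then have "(\<lambda>N. K * (norm w ^ N / (1 - norm w))) \<longlonglongrightarrow> 0"
      by (intro tendsto_mult_right_zero tendsto_divide_zero)
    then have "(\<lambda>N. G w - (\<Sum>n<N. c n * w ^ n)) \<longlonglongrightarrow> 0"
      by (rule Lim_null_comparison[OF always_eventually[OF allI[OF le]]])
    from tendsto_diff[OF tendsto_const[of "G w"] this] show ?thesis
      by (simp add: sums_def)
  qed
  define R where "R = 1 / q"
  have R: "R > 1" using q by (simp add: R_def)
  have Psums: "(\<lambda>n. c n * w ^ n) sums P w" if "norm w < R" for w
  proof -
    have "\<forall>\<^sub>F n in sequentially. norm (c n * w ^ n) \<le> C * (q * norm w) ^ n"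
      using decay
    proof eventually_elim
      case (elim n)
      have "norm (c n * w ^ n) \<le> (C * q ^ n) * norm w ^ n"
        unfolding norm_mult norm_power using elim by (intro mult_right_mono) (auto simp: c_def)
      then show ?case by (simp add: power_mult_distrib mult_ac)
    qed
    moreover have "summable (\<lambda>n. C * (q * norm w) ^ n)"
      using that q by (intro summable_mult summable_geometric) (auto simp: R_def field_simps)
    ultimately have "summable (\<lambda>n. c n * w ^ n)"
      by (rule summable_comparison_test_ev)
    then show ?thesis unfolding P_def by (rule summable_sums)
  qed
  have holP: "P holomorphic_on ball 0 R"
    by (rule power_series_holomorphic[of _ _ c]) (use Psums in auto)
  \<comment> \<open>\<open>T\<close> is the inner disc and an annulus beyond the unit circle, joined by the left half of the large disc.\<close>
  define T where "T = ball 0 1 \<union> (ball 0 R \<inter> {w. Re w < 0}) \<union> {w. 1 < norm (w - 0) \<and> norm (w - 0) < R}"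
  have TD: "T \<subseteq> D" and TR: "T \<subseteq> ball 0 R" using R by (auto simp: T_def D_def)
  have PG: "P w = G w" if "w \<in> T" for w
  proof (rule analytic_continuation_open[of "ball 0 1" T P G])
    show "open T" unfolding T_def
      by (intro open_Un open_Int open_Collect_less open_Collect_conj continuous_intros open_ball)
    show "connected T" unfolding T_def
    proof (intro connected_Un connected_annulus)
      show "connected (ball 0 R \<inter> {w. Re w < 0})"
        by (intro convex_connected convex_Int convex_ball convex_halfspace_Re_lt)
      have "- of_real ((min R 2) / 4) \<in> ball 0 1 \<inter> (ball 0 R \<inter> {w. Re w < 0})"
        using R by (auto simp: norm_minus_cancel simp del: of_real_divide)
      then show "ball 0 1 \<inter> (ball 0 R \<inter> {w. Re w < 0}) \<noteq> {}" by blast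
      have "- of_real ((1 + R) / 2) \<in> (ball 0 1 \<union> ball 0 R \<inter> {w. Re w < 0})
          \<inter> {w::complex. 1 < norm (w - 0) \<and> norm (w - 0) < R}"
        using R by (auto simp: norm_minus_cancel simp del: of_real_divide of_real_add)
      then show "(ball 0 1 \<union> ball 0 R \<inter> {w. Re w < 0})
          \<inter> {w::complex. 1 < norm (w - 0) \<and> norm (w - 0) < R} \<noteq> {}" by blast
    qed auto
    show "P z = G z" if "z \<in> ball 0 1" for z
      using sums_unique2[OF Psums Gsums] that R by simp
  qed (use that holP holG TD TR T_def in \<open>auto intro: holomorphic_on_subset\<close>)
  define H where "H w = (if norm w < R then P w else G w)" for w
  have HP: "H w = P w" if "norm w < R" for w using that by (simp add: H_def)
  have HG: "H w = G w" if "norm w > 1" for w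
    using that PG[of w] by (auto simp: H_def T_def)
  have "H holomorphic_on ball 0 R \<union> {w. norm w > 1}"
  proof (rule holomorphic_on_Un)
    show "H holomorphic_on ball 0 R"
      using holP by (rule holomorphic_transform) (simp add: HP)
    show "H holomorphic_on {w. norm w > 1}"
      using holomorphic_on_subset[OF holG, of "{w. norm w > 1}"]
      by (rule holomorphic_transform) (auto simp: HG D_def)
  qed (auto intro!: open_Collect_less continuous_intros)
  moreover have "ball 0 R \<union> {w::complex. norm w > 1} = UNIV" using R by (auto simp: not_less)
  ultimately have "H holomorphic_on UNIV" by simp
  moreover have "(H \<longlongrightarrow> 0) at_infinity"
  proof (rule Lim_null_comparison)
    show "\<forall>\<^sub>F w in at_infinity. norm (H w) \<le> K * (1 / (norm w - 1))"
      unfolding eventually_at_infinity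
    proof (intro exI[of _ 2] allI impI)
      fix w :: complex assume w: "2 \<le> norm w"
      then have D: "w \<in> D" by (simp add: D_def)
      have "G w = integral ?X (\<lambda>x. \<Phi> x * (1 / (1 - w * u x)))" by (simp add: G_def)
      also have "norm \<dots> \<le> K * (1 / (norm w - 1))"
      proof (rule bound)
        show "continuous_on ?X (\<lambda>x. 1 / (1 - w * u x))"
          using nz[OF D] by (intro continuous_intros cont) auto
        fix x assume x: "x \<in> ?X"
        have "norm w - 1 \<le> norm (1 - w * u x)"
          using norm_triangle_ineq2[of "w * u x" 1] unit[OF x] by (simp add: norm_mult norm_minus_commute)
        then show "norm (1 / (1 - w * u x)) \<le> 1 / (norm w - 1)"
          using w by (simp add: norm_divide frac_le)
      qed (use w in auto)
      finally show "norm (H w) \<le> K * (1 / (norm w - 1))" using w by (simp add: HG)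
    qed
    have "filterlim (\<lambda>w::complex. norm w - 1) at_top at_infinity"
      using filterlim_tendsto_add_at_top[OF tendsto_const[of "-1"] filterlim_norm_at_top] by simp
    then have "((\<lambda>w::complex. 1 / (norm w - 1)) \<longlongrightarrow> 0) at_infinity"
      by (intro tendsto_divide_0[OF tendsto_const] filterlim_at_top_imp_at_infinity)
    then show "((\<lambda>w::complex. K * (1 / (norm w - 1))) \<longlongrightarrow> 0) at_infinity"
      by (rule tendsto_mult_right_zero)
  qed
  ultimately have "H 0 = 0" by (rule Liouville_weak)
  then have "G 0 = 0" using R PG[of 0] by (simp add: HP T_def)
  then show ?thesis by (simp add: G_def)
qed

text \<open>
  Sampling at the multiples of \<open>\<tau>\<close> turns the integrals into moments of \<open>u = exp (-i \<tau> \<psi>)\<close>. The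
  phase is bounded on the box, so a small \<open>\<tau>\<close> keeps \<open>\<tau> \<psi>\<close> within \<open>[-1, 1]\<close> and thereby \<open>u\<close> in
  the right half-plane.
\<close>

lemma integral_eq_0_if_fourier_decay:
  fixes \<Phi> :: "'a::euclidean_space \<Rightarrow> complex" and \<psi> :: "'a \<Rightarrow> real"
  assumes cont: "continuous_on (cbox a b) \<Phi>" "continuous_on (cbox a b) \<psi>"
    and \<epsilon>: "\<epsilon> > 0"
    and decay: "\<forall>\<^sub>F \<alpha> in at_top.
      norm (integral (cbox a b) (\<lambda>x. \<Phi> x * exp (- (\<i> * of_real (\<alpha> * \<psi> x))))) \<le> C * exp (- (\<epsilon> * \<alpha>))"
  shows "integral (cbox a b) \<Phi> = 0"
proof -
  obtain B where B: "B > 0" "\<And>x. x \<in> cbox a b \<Longrightarrow> \<bar>\<psi> x\<bar> \<le> B"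
    using compact_imp_bounded[OF compact_continuous_image[OF cont(2) compact_cbox]]
    unfolding bounded_pos by auto
  define \<tau> where "\<tau> = 1 / B"
  define u where "u x = exp (- (\<i> * of_real (\<tau> * \<psi> x)))" for x
  have \<tau>: "\<tau> > 0" using B by (simp add: \<tau>_def)
  show ?thesis
  proof (rule integral_eq_0_if_moments_decay[where u = u and q = "exp (- (\<epsilon> * \<tau>))" and C = C])
    show "continuous_on (cbox a b) u" unfolding u_def by (intro continuous_intros cont)
    show "norm (u x) = 1" for x by (simp add: u_def norm_exp_eq_Re)
    show "Re (u x) > 0" if "x \<in> cbox a b" for x
    proof -
      have "\<bar>\<tau> * \<psi> x\<bar> \<le> 1" using B that by (simp add: \<tau>_def field_simps abs_mult)
      then have "cos (\<tau> * \<psi> x) > 0" using pi_half_gt_zero pi_gt3 by (intro cos_gt_zero_pi) linarith+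
      then show ?thesis by (simp add: u_def Re_exp)
    qed
    have "filterlim (\<lambda>n. \<tau> * real n) at_top sequentially"
      using \<tau> by (intro filterlim_tendsto_pos_mult_at_top[OF tendsto_const] filterlim_real_sequentially)
    then have "\<forall>\<^sub>F n in sequentially.
        norm (integral (cbox a b) (\<lambda>x. \<Phi> x * exp (- (\<i> * of_real ((\<tau> * real n) * \<psi> x)))))
          \<le> C * exp (- (\<epsilon> * (\<tau> * real n)))"
      by (rule eventually_compose_filterlim[OF decay])
    moreover have "exp (- (\<i> * of_real ((\<tau> * real n) * \<psi> x))) = u x ^ n" for n x
      by (simp add: u_def mult_ac flip: exp_of_nat_mult)
    moreover have "exp (- (\<epsilon> * (\<tau> * real n))) = exp (- (\<epsilon> * \<tau>)) ^ n" for n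
      by (simp add: mult_ac flip: exp_of_nat_mult)
    ultimately show "\<forall>\<^sub>F n in sequentially.
        norm (integral (cbox a b) (\<lambda>x. \<Phi> x * u x ^ n)) \<le> C * exp (- (\<epsilon> * \<tau>)) ^ n"
      by simp
  qed (use cont \<epsilon> \<tau> in auto)
qed

lemma integral_times_integral:
  fixes f :: "'a::euclidean_space \<Rightarrow> complex" and g :: "'b::euclidean_space \<Rightarrow> complex"
  assumes "continuous_on (cbox a b) f" "continuous_on (cbox c d) g"
  shows "integral (cbox (a, c) (b, d)) (\<lambda>z. f (fst z) * g (snd z))
    = integral (cbox a b) f * integral (cbox c d) g"
proof -
  have "continuous_on (cbox (a, c) (b, d)) (\<lambda>z. f (fst z) * g (snd z))"
    by (intro continuous_intros continuous_on_compose2[OF assms(1)] continuous_on_compose2[OF assms(2)])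
       (auto simp: cbox_Pair_eq)
  then show ?thesis by (simp add: integral_prod_continuous)
qed

section \<open>Integration along a chord with endpoint singularities\<close>

text \<open>
  The orthogonal projection of a half circle onto the segment from \<open>c\<close> to \<open>d\<close>. Its speed
  is proportional to \<open>sin \<theta>\<close> and so cancels a factor \<open>1 / sqrt (x (1 - x))\<close> in the linear
  parameter \<open>x\<close>.
\<close>

definition chord :: "complex \<Rightarrow> complex \<Rightarrow> real \<Rightarrow> complex" where
  "chord c d \<theta> = linepath c d ((1 - cos \<theta>) / 2)"

lemma chord_eq: "chord c d \<theta> = (c + d) / 2 - (d - c) / 2 * of_real (cos \<theta>)"
  by (simp add: chord_def linepath_def scaleR_conv_of_real field_simps)

text \<open>
  The integrand may be unbounded at both endpoints. The change of variables for absolutely integrable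
  functions transfers integrability from \<open>\<Phi>\<close> back to \<open>f\<close>, so integrability of \<open>f\<close> is a
  consequence of the continuity of \<open>\<Phi>\<close>.
\<close>

lemma contour_integral_chord:
  assumes cont: "continuous_on {0..pi} \<Phi>"
    and eq: "\<And>\<theta>. \<lbrakk>0 < \<theta>; \<theta> < pi\<rbrakk> \<Longrightarrow> f (chord c d \<theta>) * (d - c) * of_real (sin \<theta> / 2) = \<Phi> \<theta>"
  shows "contour_integral (linepath c d) f = integral {0..pi} \<Phi>"
proof -
  let ?g = "\<lambda>\<theta>::real. (1 - cos \<theta>) / 2"
  let ?h = "\<lambda>\<theta>. \<bar>sin \<theta> / 2\<bar> *\<^sub>R (f (linepath c d (?g \<theta>)) * (d - c))"
  have image: "?g ` {0..pi} = {0..1}"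
  proof
    have "0 \<le> ?g \<theta> \<and> ?g \<theta> \<le> 1" for \<theta>
      using cos_ge_minus_one[of \<theta>] cos_le_one[of \<theta>] by simp
    then show "?g ` {0..pi} \<subseteq> {0..1}" by auto
    show "{0..1} \<subseteq> ?g ` {0..pi}"
    proof
      fix x :: real assume "x \<in> {0..1}"
      then have "x = ?g (arccos (1 - 2 * x))" "arccos (1 - 2 * x) \<in> {0..pi}"
        by (auto simp: arccos_lbound arccos_ubound)
      then show "x \<in> ?g ` {0..pi}" by (rule image_eqI)
    qed
  qed
  have h: "?h \<theta> = \<Phi> \<theta>" if "\<theta> \<in> {0..pi} - {0, pi}" for \<theta>
  proof -
    have "0 < \<theta>" "\<theta> < pi" using that by auto
    then show ?thesis using eq[of \<theta>] sin_gt_zero[of \<theta>]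
      by (simp add: chord_def scaleR_conv_of_real mult_ac)
  qed
  have "\<Phi> absolutely_integrable_on {0..pi}"
    using cont by (rule absolutely_integrable_continuous_real)
  then have "?h absolutely_integrable_on {0..pi}"
    by (rule absolutely_integrable_spike[of _ _ "{0, pi}"]) (use h in auto)
  moreover have "integral {0..pi} ?h = integral {0..pi} \<Phi>"
    by (rule integral_spike[of "{0, pi}"]) (use h in auto)
  moreover have "inj_on ?g {0..pi}"
    by (rule inj_onI) (auto dest: cos_inj_pi[rotated 4])
  moreover have "(?g has_field_derivative sin \<theta> / 2) (at \<theta> within {0..pi})" for \<theta>
    by (auto intro!: derivative_eq_intros)
  ultimately have "(\<lambda>x. f (linepath c d x) * (d - c)) absolutely_integrable_on ?g ` {0..pi} \<and>
      integral (?g ` {0..pi}) (\<lambda>x. f (linepath c d x) * (d - c)) = integral {0..pi} \<Phi>"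
    by (subst has_absolute_integral_change_of_variables_real[symmetric, where h = "\<lambda>\<theta>. sin \<theta> / 2"])
       simp_all
  then have "((\<lambda>x. f (linepath c d x) * (d - c)) has_integral integral {0..pi} \<Phi>) {0..1}"
    unfolding image absolutely_integrable_on_def has_integral_iff by blast
  then show ?thesis
    by (intro contour_integral_unique) (simp add: has_contour_integral_linepath)
qed

section \<open>Laplace integrals\<close>

lemma laplace_integral_pos:
  fixes u p :: "real \<Rightarrow> real"
  assumes "c < d" "continuous_on {c..d} u" "continuous_on {c..d} p"
    and "\<And>x. \<lbrakk>c < x; x < d\<rbrakk> \<Longrightarrow> u x > 0"
  shows "integral {c..d} (\<lambda>x. u x * exp (- (\<alpha> * p x))) > 0"
proof -
  have "integral {c..d} (\<lambda>x. 0) < integral {c..d} (\<lambda>x. u x * exp (- (\<alpha> * p x)))"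
    using assms by (intro integral_less_real continuous_intros) auto
  then show ?thesis by simp
qed

text \<open>
  The exponential is at most \<open>exp (-\<alpha> (p c))\<close> everywhere and at least \<open>exp (-\<alpha> (p c + e))\<close> on a
  short interval next to \<open>c\<close>; the positive constants in front disappear after dividing the logarithm
  by \<open>\<alpha>\<close>.
\<close>

lemma ln_laplace_integral_over_tendsto:
  fixes u p :: "real \<Rightarrow> real"
  assumes cd: "c < d" and contu: "continuous_on {c..d} u" and contp: "continuous_on {c..d} p"
    and nonneg: "\<And>x. x \<in> {c..d} \<Longrightarrow> u x \<ge> 0"
    and pos: "\<And>x. \<lbrakk>c < x; x < d\<rbrakk> \<Longrightarrow> u x > 0"
    and min: "\<And>x. x \<in> {c..d} \<Longrightarrow> p c \<le> p x"
  shows "((\<lambda>\<alpha>. ln (integral {c..d} (\<lambda>x. u x * exp (- (\<alpha> * p x)))) / \<alpha>) \<longlongrightarrow> - p c) at_top"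
proof -
  define F where "F \<alpha> = integral {c..d} (\<lambda>x. u x * exp (- (\<alpha> * p x)))" for \<alpha>
  have Fpos: "F \<alpha> > 0" for \<alpha>
    unfolding F_def by (rule laplace_integral_pos) fact+
  have small: "\<forall>\<^sub>F \<alpha> in at_top. \<bar>k / \<alpha>\<bar> < e" if "e > 0" for k e :: real
  proof -
    have "((\<lambda>\<alpha>::real. k / \<alpha>) \<longlongrightarrow> 0) at_top" by real_asymp
    from tendstoD[OF this \<open>e > 0\<close>] show ?thesis by (simp add: dist_real_def)
  qed
  have "((\<lambda>\<alpha>. ln (F \<alpha>) / \<alpha>) \<longlongrightarrow> - p c) at_top"
  proof (rule order_tendstoI)
    fix y assume "- p c < y"
    then have yc: "y + p c > 0" by simp
    define U where "U = integral {c..d} u"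
    have U: "U > 0" using laplace_integral_pos[OF cd contu contp pos, of 0] by (simp add: U_def)
    show "\<forall>\<^sub>F \<alpha> in at_top. ln (F \<alpha>) / \<alpha> < y"
      using small[OF yc, of "ln U"] eventually_gt_at_top[of 0]
    proof eventually_elim
      case (elim \<alpha>)
      have "F \<alpha> \<le> integral {c..d} (\<lambda>x. u x * exp (- (\<alpha> * p c)))"
        unfolding F_def using elim min nonneg
        by (intro integral_le integrable_continuous_real continuous_intros contu contp mult_left_mono) auto
      also have "\<dots> = U * exp (- (\<alpha> * p c))" by (simp add: U_def)
      finally have "ln (F \<alpha>) \<le> ln (U * exp (- (\<alpha> * p c)))"
        using Fpos[of \<alpha>] U by (subst ln_le_cancel_iff) auto
      also have "\<dots> = ln U - \<alpha> * p c" using U by (simp add: ln_mult)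
      finally have "ln (F \<alpha>) / \<alpha> \<le> (ln U - \<alpha> * p c) / \<alpha>" using elim by (intro divide_right_mono) auto
      also have "\<dots> = ln U / \<alpha> - p c" using elim by (simp add: field_simps)
      also have "\<dots> < y" using elim by linarith
      finally show ?case .
    qed
  next
    fix y assume y: "y < - p c"
    define e where "e = (- p c - y) / 2"
    have e: "e > 0" using y by (simp add: e_def)
    obtain \<delta> where \<delta>: "\<delta> > 0" "\<And>x. x \<in> {c..d} \<Longrightarrow> dist x c < \<delta> \<Longrightarrow> dist (p x) (p c) < e"
      using contp e cd unfolding continuous_on_iff by (metis atLeastAtMost_iff less_eq_real_def)
    define m where "m = min d (c + \<delta> / 2)"
    have m: "c < m" "m \<le> d" using cd \<delta> by (auto simp: m_def)
    have contm: "continuous_on {c..m} u" "continuous_on {c..m} p"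
      using contu contp m by (auto elim!: continuous_on_subset)
    have pm: "p x \<le> p c + e" if "x \<in> {c..m}" for x
      using \<delta>(2)[of x] that \<open>\<delta> > 0\<close> m by (auto simp: dist_real_def m_def)
    define U where "U = integral {c..m} u"
    have U: "U > 0" using laplace_integral_pos[OF m(1) contm, of 0] pos m by (simp add: U_def)
    show "\<forall>\<^sub>F \<alpha> in at_top. y < ln (F \<alpha>) / \<alpha>"
      using small[OF e, of "ln U"] eventually_gt_at_top[of 0]
    proof eventually_elim
      case (elim \<alpha>)
      have "U * exp (- (\<alpha> * (p c + e))) = integral {c..m} (\<lambda>x. u x * exp (- (\<alpha> * (p c + e))))"
        by (simp add: U_def)
      also have "\<dots> \<le> integral {c..m} (\<lambda>x. u x * exp (- (\<alpha> * p x)))"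
        using elim pm nonneg m
        by (intro integral_le integrable_continuous_real continuous_intros contm mult_left_mono) auto
      also have "\<dots> \<le> F \<alpha>"
        unfolding F_def using m nonneg
        by (intro integral_subset_le integrable_continuous_real continuous_intros contm contu contp) auto
      finally have "ln (U * exp (- (\<alpha> * (p c + e)))) \<le> ln (F \<alpha>)"
        using Fpos[of \<alpha>] U by (subst ln_le_cancel_iff) auto
      moreover have "ln (U * exp (- (\<alpha> * (p c + e)))) = ln U - \<alpha> * (p c + e)" using U by (simp add: ln_mult)
      ultimately have "(ln U - \<alpha> * (p c + e)) / \<alpha> \<le> ln (F \<alpha>) / \<alpha>"
        using elim by (intro divide_right_mono) auto
      moreover have "(ln U - \<alpha> * (p c + e)) / \<alpha> = ln U / \<alpha> - p c - e" using elim by (simp add: field_simps)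
      moreover have "2 * e = - p c - y" by (simp add: e_def)
      ultimately show ?case using elim by linarith
    qed
  qed
  then show ?thesis by (simp add: F_def)
qed

text \<open>
  This covers a rate of 0, where the logarithmic asymptotics cannot tell whether the integral tends
  to 0. Off the point \<open>c\<close> the integrand tends to 0, dominated by \<open>\<bar>u\<bar>\<close>.
\<close>

lemma laplace_integral_tendsto_0:
  fixes u p :: "real \<Rightarrow> real"
  assumes contu: "continuous_on {c..d} u" and contp: "continuous_on {c..d} p"
    and pos: "\<And>x. \<lbrakk>c < x; x \<le> d\<rbrakk> \<Longrightarrow> p x > 0" and "p c \<ge> 0"
  shows "((\<lambda>\<alpha>. integral {c..d} (\<lambda>x. u x * exp (- (\<alpha> * p x)))) \<longlongrightarrow> 0) at_top"
proof (rule tendsto_at_topI_sequentially)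
  fix X :: "nat \<Rightarrow> real" assume X: "filterlim X at_top sequentially"
  obtain N where N: "\<And>n. n \<ge> N \<Longrightarrow> X n \<ge> 0"
    using X unfolding filterlim_at_top eventually_sequentially by blast
  \<comment> \<open>At \<open>x = c\<close> the exponent may vanish, so the pointwise limit there need not be 0.\<close>
  let ?g = "\<lambda>x. if x = c then u c * (if p c = 0 then 1 else 0) else 0"
  have nonneg: "p x \<ge> 0" if "x \<in> {c..d}" for x
    using that pos[of x] \<open>p c \<ge> 0\<close> by (cases "x = c") auto
  have "(\<lambda>n. integral {c..d} (\<lambda>x. u x * exp (- (X (n + N) * p x)))) \<longlonglongrightarrow> integral {c..d} ?g"
  proof (rule dominated_convergence)
    show "(\<lambda>x. u x * exp (- (X (n + N) * p x))) integrable_on {c..d}" for n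
      by (intro integrable_continuous_real continuous_intros contu contp)
    show "(\<lambda>x. \<bar>u x\<bar>) integrable_on {c..d}"
      by (intro integrable_continuous_real continuous_intros contu)
    show "norm (u x * exp (- (X (n + N) * p x))) \<le> \<bar>u x\<bar>" if "x \<in> {c..d}" for n x
      using nonneg[OF that] N[of "n + N"] by (simp add: abs_mult mult_left_le)
    show "(\<lambda>n. u x * exp (- (X (n + N) * p x))) \<longlonglongrightarrow> ?g x" if x: "x \<in> {c..d}" for x
    proof (cases "p x = 0")
      case True
      then have "x = c" using pos[of x] x by (cases "x = c") auto
      then show ?thesis using True by simp
    next
      case False
      then have "p x > 0" using nonneg[OF x] by simp
      have "filterlim (\<lambda>n. X (n + N)) at_top sequentially"
        using X by (rule filterlim_compose) (rule filterlim_add_const_nat_at_top)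
      then have "filterlim (\<lambda>n. X (n + N) * p x) at_top sequentially"
        by (rule filterlim_at_top_mult_tendsto_pos[OF tendsto_const \<open>p x > 0\<close>])
      then have "(\<lambda>n. u x * exp (- (X (n + N) * p x))) \<longlonglongrightarrow> 0"
        by (intro tendsto_mult_right_zero filterlim_compose[OF exp_at_bot])
           (simp add: filterlim_uminus_at_bot)
      then show ?thesis using False by auto
    qed
  qed
  moreover have "integral {c..d} ?g = integral {c..d} (\<lambda>x. 0)"
    by (rule integral_spike[of "{c}"]) auto
  ultimately show "(\<lambda>n. integral {c..d} (\<lambda>x. u x * exp (- (X n * p x)))) \<longlonglongrightarrow> 0"
    using LIMSEQ_offset by simp
qed

section \<open>From decay rates to decay lengths\<close>

text \<open>
  Here \<open>f\<close> may vanish for arbitrarily large \<open>\<alpha>\<close>; the quotient is 0 at such points, which is harmless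
  for an upper limit. If the upper limit were below some \<open>y < 1 / k\<close>, then \<open>f \<alpha> \<le> exp (-\<alpha> / y)\<close>
  eventually, a faster exponential decay than \<open>lower\<close> permits.
\<close>

lemma Limsup_decay_length:
  fixes f :: "real \<Rightarrow> real"
  assumes k: "k > 0" and K: "K > 0"
    and nonneg: "\<And>\<alpha>. f \<alpha> \<ge> 0"
    and upper: "\<And>\<alpha>. f \<alpha> \<le> K * exp (- (k * \<alpha>))"
    and lower: "\<And>\<epsilon>. \<epsilon> > 0 \<Longrightarrow> \<not> (\<forall>\<^sub>F \<alpha> in at_top. f \<alpha> \<le> exp (- ((k + \<epsilon>) * \<alpha>)))"
  shows "Limsup at_top (\<lambda>\<alpha>. ereal (- (\<alpha> / ln (f \<alpha>)))) = ereal (1 / k)"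
proof (rule antisym)
  define v where "v \<alpha> = \<alpha> / (k * \<alpha> - ln K)" for \<alpha>
  have "\<forall>\<^sub>F \<alpha> in at_top. k * \<alpha> - ln K > 0" using k by real_asymp
  then have ln_neg: "\<forall>\<^sub>F \<alpha> in at_top. \<alpha> > 0 \<and> k * \<alpha> - ln K > 0 \<and>
      (f \<alpha> > 0 \<longrightarrow> ln (f \<alpha>) \<le> - (k * \<alpha> - ln K))"
    using eventually_gt_at_top[of 0]
  proof eventually_elim
    case (elim \<alpha>)
    have "ln (f \<alpha>) \<le> - (k * \<alpha> - ln K)" if "f \<alpha> > 0"
    proof -
      have "ln (f \<alpha>) \<le> ln (K * exp (- (k * \<alpha>)))"
        using upper[of \<alpha>] that K by (subst ln_le_cancel_iff) auto
      then show ?thesis using K by (simp add: ln_mult)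
    qed
    with elim show ?case by blast
  qed
  have "\<forall>\<^sub>F \<alpha> in at_top. - (\<alpha> / ln (f \<alpha>)) \<le> v \<alpha>"
    using ln_neg
  proof eventually_elim
    case (elim \<alpha>)
    show ?case
    proof (cases "f \<alpha> = 0")
      case True
      then show ?thesis using elim by (simp add: v_def)
    next
      case False
      then have "k * \<alpha> - ln K \<le> - ln (f \<alpha>)" using elim nonneg[of \<alpha>] by auto
      then have "\<alpha> / - ln (f \<alpha>) \<le> v \<alpha>" unfolding v_def using elim by (intro frac_le) auto
      then show ?thesis by simp
    qed
  qed
  then have "Limsup at_top (\<lambda>\<alpha>. ereal (- (\<alpha> / ln (f \<alpha>)))) \<le> Limsup at_top (\<lambda>\<alpha>. ereal (v \<alpha>))"
    by (intro Limsup_mono) simp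
  also have "\<dots> = ereal (1 / k)"
  proof (rule lim_imp_Limsup)
    have "(v \<longlongrightarrow> inverse k) at_top" unfolding v_def using k by real_asymp
    then show "((\<lambda>\<alpha>. ereal (v \<alpha>)) \<longlongrightarrow> ereal (1 / k)) at_top" by (simp add: inverse_eq_divide)
  qed simp
  finally show "Limsup at_top (\<lambda>\<alpha>. ereal (- (\<alpha> / ln (f \<alpha>)))) \<le> ereal (1 / k)" .
  show "ereal (1 / k) \<le> Limsup at_top (\<lambda>\<alpha>. ereal (- (\<alpha> / ln (f \<alpha>))))"
  proof (rule ccontr)
    assume "\<not> ?thesis"
    then have "Limsup at_top (\<lambda>\<alpha>. ereal (- (\<alpha> / ln (f \<alpha>)))) < ereal (1 / k)"
      by (simp only: not_le)
    from ereal_dense2[OF this] obtain y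
      where y: "Limsup at_top (\<lambda>\<alpha>. ereal (- (\<alpha> / ln (f \<alpha>)))) < ereal y" "y < 1 / k"
      by auto
    have less: "\<forall>\<^sub>F \<alpha> in at_top. - (\<alpha> / ln (f \<alpha>)) < y"
      using Limsup_lessD[OF y(1)] by simp
    have "\<forall>\<^sub>F \<alpha>::real in at_top. y > 0"
      using less ln_neg
    proof eventually_elim
      case (elim \<alpha>)
      have "ln (f \<alpha>) \<le> 0"
      proof (cases "f \<alpha> = 0")
        case False
        then have "ln (f \<alpha>) \<le> - (k * \<alpha> - ln K)" using elim nonneg[of \<alpha>] by simp
        then show ?thesis using elim by linarith
      qed simp
      then have "\<alpha> / ln (f \<alpha>) \<le> 0"
        using elim by (intro divide_nonneg_nonpos) auto
      with elim show ?case by linarith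
    qed
    then have ypos: "y > 0" by simp
    define \<epsilon> where "\<epsilon> = 1 / y - k"
    have "\<epsilon> > 0" using y(2) ypos k by (simp add: \<epsilon>_def field_simps)
    have "\<forall>\<^sub>F \<alpha> in at_top. f \<alpha> \<le> exp (- ((k + \<epsilon>) * \<alpha>))"
      using less ln_neg
    proof eventually_elim
      case (elim \<alpha>)
      show ?case
      proof (cases "f \<alpha> = 0")
        case False
        then have pos: "f \<alpha> > 0" using nonneg[of \<alpha>] by simp
        then have neg: "- ln (f \<alpha>) > 0" using elim by linarith
        have "\<alpha> / - ln (f \<alpha>) < y" using elim by simp
        then have "\<alpha> < y * - ln (f \<alpha>)" using neg by (simp only: pos_divide_less_eq)
        then have "ln (f \<alpha>) \<le> - (\<alpha> / y)" using ypos by (simp add: field_simps)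
        then have "f \<alpha> \<le> exp (- (\<alpha> / y))" using pos by (metis exp_le_cancel_iff exp_ln)
        then show ?thesis by (simp add: \<epsilon>_def)
      qed simp
    qed
    with lower[OF \<open>\<epsilon> > 0\<close>] show False by blast
  qed
qed

lemma decay_length_tendsto:
  fixes f :: "real \<Rightarrow> real"
  assumes "((\<lambda>\<alpha>. ln (f \<alpha>) / \<alpha>) \<longlongrightarrow> - k) at_top" "k \<noteq> 0"
  shows "((\<lambda>\<alpha>. - (\<alpha> / ln (f \<alpha>))) \<longlongrightarrow> 1 / k) at_top"
proof -
  have "((\<lambda>\<alpha>. - inverse (ln (f \<alpha>) / \<alpha>)) \<longlongrightarrow> - inverse (- k)) at_top"
    using assms by (intro tendsto_intros) auto
  then show ?thesis by (simp add: inverse_eq_divide)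
qed

lemma decay_length_at_top:
  fixes f :: "real \<Rightarrow> real"
  assumes "((\<lambda>\<alpha>. ln (f \<alpha>) / \<alpha>) \<longlongrightarrow> 0) at_top" "(f \<longlongrightarrow> 0) at_top" "\<And>\<alpha>. f \<alpha> > 0"
  shows "filterlim (\<lambda>\<alpha>. - (\<alpha> / ln (f \<alpha>))) at_top at_top"
proof -
  have "\<forall>\<^sub>F \<alpha> in at_top. 0 < - (ln (f \<alpha>) / \<alpha>)"
    using order_tendstoD(2)[OF assms(2) zero_less_one] eventually_gt_at_top[of 0]
  proof eventually_elim
    case (elim \<alpha>)
    then have "ln (f \<alpha>) < 0" using assms(3)[of \<alpha>] by simp
    then show ?case using elim by (simp add: divide_neg_pos)
  qed
  moreover have "((\<lambda>\<alpha>. - (ln (f \<alpha>) / \<alpha>)) \<longlongrightarrow> 0) at_top"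
    using tendsto_minus[OF assms(1)] by simp
  ultimately have "filterlim (\<lambda>\<alpha>. inverse (- (ln (f \<alpha>) / \<alpha>))) at_top at_top"
    by (intro filterlim_inverse_at_top)
  then show ?thesis by (simp add: inverse_eq_divide)
qed

section \<open>The covariance below the critical value\<close>

text \<open>
  In terms of \<open>s\<close> the three cases in the definition of \<open>e2\<close> become the single formula
  \<open>\<bar>2 - s\<bar>\<close>, so that \<open>\<gamma> < -1\<close>, \<open>\<gamma> = -1\<close> and \<open>-1 < \<gamma> < 1\<close> are treated together.
\<close>

lemma endpoints_below_1:
  assumes "\<gamma> < 1"
  defines "s \<equiv> sqrt (2 * (1 - \<gamma>))"
  shows "s > 0" "\<gamma> = 1 - s\<^sup>2 / 2" "e1 \<gamma> = of_real (2 + s)" "e2 \<gamma> = of_real \<bar>2 - s\<bar>"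
    "s = 2 \<longleftrightarrow> \<gamma> = -1"
proof -
  show "s > 0" and g: "\<gamma> = 1 - s\<^sup>2 / 2" using assms by (auto simp: s_def field_simps)
  have "s < 2 \<longleftrightarrow> \<gamma> > -1" and "s > 2 \<longleftrightarrow> \<gamma> < -1" and "s = 2 \<longleftrightarrow> \<gamma> = -1"
    unfolding s_def using assms
    by (auto simp: real_sqrt_less_iff[of _ 4, simplified] real_sqrt_less_iff[of 4, simplified]
          real_sqrt_eq_iff[of _ 4, simplified])
  then show "e2 \<gamma> = of_real \<bar>2 - s\<bar>" "s = 2 \<longleftrightarrow> \<gamma> = -1"
    using assms by (auto simp: e2_real s_def)
  show "e1 \<gamma> = of_real (2 + s)" using assms by (simp add: e1_real s_def)
qed

text \<open>
  With \<open>a = e2 \<gamma>\<close>, \<open>b = e1 \<gamma>\<close> and \<open>S = sqrt ((p + a) (p + b))\<close>, the root is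
  \<open>R = sqrt ((p - a) (b - p)) S\<close>, whose first factor is absorbed by the substitution. The functions
  \<open>u1\<close> and \<open>u2\<close> are \<open>v / S\<close> and \<open>w / S\<close>, and the factorisations
  \<open>v = (p - (2 - s)) (b - p)\<close> and \<open>w = (p + 2 - s) (p + b)\<close> show their sign, because
  \<open>\<bar>2 - s\<bar> = a < p < b\<close>.
\<close>

lemma cov_below_1:
  assumes \<gamma>: "\<gamma> < 1"
  obtains u1 u2 p :: "real \<Rightarrow> real"
  where "continuous_on {0..pi} u1" "continuous_on {0..pi} u2" "continuous_on {0..pi} p"
    "\<And>\<theta>. \<theta> \<in> {0..pi} \<Longrightarrow> u1 \<theta> \<ge> 0" "\<And>\<theta>. \<theta> \<in> {0..pi} \<Longrightarrow> u2 \<theta> \<ge> 0"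
    "\<And>\<theta>. \<lbrakk>0 < \<theta>; \<theta> < pi\<rbrakk> \<Longrightarrow> u1 \<theta> > 0" "\<And>\<theta>. \<lbrakk>0 < \<theta>; \<theta> < pi\<rbrakk> \<Longrightarrow> u2 \<theta> > 0"
    "e2 \<gamma> = of_real (p 0)" "\<And>\<theta>. \<lbrakk>0 < \<theta>; \<theta> \<le> pi\<rbrakk> \<Longrightarrow> p 0 < p \<theta>"
    "\<And>\<alpha>. cov \<alpha> \<gamma> = of_real (integral {0..pi} (\<lambda>\<theta>. u1 \<theta> * exp (- (\<alpha> * p \<theta>)))
                           * integral {0..pi} (\<lambda>\<theta>. u2 \<theta> * exp (- (\<alpha> * p \<theta>))) / (4 * pi\<^sup>2))"
proof -
  define s where "s = sqrt (2 * (1 - \<gamma>))"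
  note s = endpoints_below_1[OF \<gamma>, folded s_def]
  define a where "a = \<bar>2 - s\<bar>"
  define b where "b = 2 + s"
  have ab: "0 \<le> a" "a < b" using s(1) by (auto simp: a_def b_def)
  define p where "p \<theta> = a + (b - a) * ((1 - cos \<theta>) / 2)" for \<theta>
  define S where "S x = sqrt ((x + a) * (x + b))" for x
  define N1 where "N1 x = x / S x" for x
  define N2 where "N2 x = (2 + 2 * \<gamma> + x\<^sup>2) / S x" for x
  \<comment> \<open>For \<open>a = 0\<close> the denominator vanishes at \<open>x = 0\<close>, but the quotient is still continuous there.\<close>
  have cont1: "continuous_on {a..b} N1"
  proof (cases "a = 0")
    case True
    have "continuous_on {a..b} (\<lambda>x. sqrt x / sqrt (x + b))"
      using ab by (intro continuous_intros) auto
    moreover have "sqrt x / sqrt (x + b) = N1 x" if "x \<in> {a..b}" for x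
      using True that by (simp add: N1_def S_def real_sqrt_mult real_div_sqrt flip: divide_divide_eq_left)
    ultimately show ?thesis by (rule continuous_on_eq)
  next
    case False
    then show ?thesis unfolding N1_def S_def using ab by (intro continuous_intros) auto
  qed
  have cont2: "continuous_on {a..b} N2"
  proof (cases "a = 0")
    case True
    then have "s = 2" by (simp add: a_def)
    then have "N2 = (\<lambda>x. x * N1 x)" using s(5) by (auto simp: N1_def N2_def power2_eq_square)
    then show ?thesis using cont1 by (auto intro: continuous_intros)
  next
    case False
    then show ?thesis unfolding N2_def S_def using ab by (intro continuous_intros) auto
  qed
  have contp: "continuous_on X p" for X unfolding p_def by (intro continuous_intros) auto
  have p_in: "p \<theta> \<in> {a..b}" for \<theta>
  proof -
    have "(b - a) * ((1 - cos \<theta>) / 2) \<le> (b - a) * 1"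
      using ab cos_ge_minus_one[of \<theta>] by (intro mult_left_mono) auto
    then show ?thesis using ab by (simp add: p_def)
  qed
  have contN: "continuous_on {0..pi} (\<lambda>\<theta>. N1 (p \<theta>))" "continuous_on {0..pi} (\<lambda>\<theta>. N2 (p \<theta>))"
    using p_in by (auto intro!: continuous_on_compose2[OF cont1 contp] continuous_on_compose2[OF cont2 contp])
  have p_low: "a < p \<theta>" if "0 < \<theta>" "\<theta> \<le> pi" for \<theta>
    using that ab cos_monotone_0_pi[of 0 \<theta>] by (simp add: p_def)
  have p_up: "p \<theta> < b" if "0 < \<theta>" "\<theta> < pi" for \<theta>
  proof -
    have "(b - a) * ((1 - cos \<theta>) / 2) < (b - a) * 1"
      using that ab cos_monotone_0_pi[of \<theta> pi] by (intro mult_strict_left_mono) auto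
    then show ?thesis by (simp add: p_def)
  qed
  have v: "4 * x - (2 + 2 * \<gamma> + x\<^sup>2) = (x - (2 - s)) * (b - x)"
    and w: "4 * x + (2 + 2 * \<gamma> + x\<^sup>2) = (x + 2 - s) * (x + b)" for x
    by (simp_all add: s(2) b_def power2_eq_square algebra_simps)
  have poly: "-4 - 8 * \<gamma> - 4 * \<gamma>\<^sup>2 + 12 * x\<^sup>2 - 4 * \<gamma> * x\<^sup>2 - x ^ 4 = ((x - a) * (b - x)) * ((x + a) * (x + b))" for x
  proof -
    have "((x - a) * (b - x)) * ((x + a) * (x + b)) = (x\<^sup>2 - a\<^sup>2) * (b\<^sup>2 - x\<^sup>2)"
      by (simp add: power2_eq_square algebra_simps)
    also have "a\<^sup>2 = (2 - s)\<^sup>2" by (simp add: a_def)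
    finally show ?thesis
      by (simp add: s(2) b_def power2_eq_square power4_eq_xxxx algebra_simps)
  qed
  have R: "Rfun \<gamma> (of_real (p \<theta>)) = of_real ((b - a) * (sin \<theta> / 2) * S (p \<theta>))" if "0 < \<theta>" "\<theta> < pi" for \<theta>
  proof -
    have "(p \<theta> - a) * (b - p \<theta>) = ((b - a) * (sin \<theta> / 2))\<^sup>2"
      by (simp add: p_def power_mult_distrib power_divide sin_squared_eq) (simp add: field_simps power2_eq_square)
    moreover have "sin \<theta> > 0" using that by (simp add: sin_gt_zero)
    ultimately have "sqrt (((p \<theta> - a) * (b - p \<theta>)) * ((p \<theta> + a) * (p \<theta> + b))) = (b - a) * (sin \<theta> / 2) * S (p \<theta>)"
      using ab by (simp add: real_sqrt_mult S_def)
    moreover have "0 \<le> ((p \<theta> - a) * (b - p \<theta>)) * ((p \<theta> + a) * (p \<theta> + b))"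
      using p_in[of \<theta>] ab by simp
    ultimately show ?thesis using Rfun_real[OF \<gamma>, of "p \<theta>"] by (simp only: poly)
  qed
  have Spos: "S (p \<theta>) > 0" if "0 < \<theta>" "\<theta> \<le> pi" for \<theta>
    using p_low[OF that] ab by (simp add: S_def)
  have e: "e2 \<gamma> = of_real a" "e1 \<gamma> = of_real b" using s by (simp_all add: a_def b_def)
  have chord: "chord (e2 \<gamma>) (e1 \<gamma>) \<theta> = of_real (p \<theta>)" for \<theta>
    by (simp add: chord_eq e p_def field_simps)
  have chord_integral: "contour_integral (linepath (e2 \<gamma>) (e1 \<gamma>)) (\<lambda>x. f x / Rfun \<gamma> x) = of_real (integral {0..pi} g)"
    if g: "continuous_on {0..pi} g" and f: "\<And>\<theta>. \<lbrakk>0 < \<theta>; \<theta> < pi\<rbrakk> \<Longrightarrow> f (of_real (p \<theta>)) = of_real (g \<theta> * S (p \<theta>))" for f g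
  proof -
    have "contour_integral (linepath (e2 \<gamma>) (e1 \<gamma>)) (\<lambda>x. f x / Rfun \<gamma> x) = integral {0..pi} (\<lambda>\<theta>. of_real (g \<theta>))"
    proof (rule contour_integral_chord)
      show "continuous_on {0..pi} (\<lambda>\<theta>. complex_of_real (g \<theta>))" by (intro continuous_intros g)
      fix \<theta> assume \<theta>: "0 < \<theta>" "\<theta> < pi"
      have "S (p \<theta>) \<noteq> 0" "sin \<theta> \<noteq> 0" "b - a \<noteq> 0" using \<theta> Spos[of \<theta>] sin_gt_zero[of \<theta>] ab by auto
      then have "(g \<theta> * S (p \<theta>)) / ((b - a) * (sin \<theta> / 2) * S (p \<theta>)) * (b - a) * (sin \<theta> / 2) = g \<theta>"
        by simp
      then show "f (chord (e2 \<gamma>) (e1 \<gamma>) \<theta>) / Rfun \<gamma> (chord (e2 \<gamma>) (e1 \<gamma>) \<theta>) * (e1 \<gamma> - e2 \<gamma>)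
          * of_real (sin \<theta> / 2) = of_real (g \<theta>)"
        unfolding chord R[OF \<theta>] f[OF \<theta>] unfolding e
        by (simp only: flip: of_real_diff of_real_divide of_real_mult)
    qed
    also have "\<dots> = of_real (integral {0..pi} g)"
      using g by (intro integral_unique has_integral_of_real integrable_integral integrable_continuous_real)
    finally show ?thesis .
  qed
  define u1 where "u1 \<theta> = 4 * N1 (p \<theta>) - N2 (p \<theta>)" for \<theta>
  define u2 where "u2 \<theta> = 4 * N1 (p \<theta>) + N2 (p \<theta>)" for \<theta>
  have u1: "u1 \<theta> = (p \<theta> - (2 - s)) * (b - p \<theta>) / S (p \<theta>)" for \<theta>
    by (simp add: u1_def N1_def N2_def flip: v diff_divide_distrib)
  have u2: "u2 \<theta> = (p \<theta> + 2 - s) * (p \<theta> + b) / S (p \<theta>)" for \<theta>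
    by (simp add: u2_def N1_def N2_def flip: w add_divide_distrib)
  show thesis
  proof (rule that[of u1 u2 p])
    show contu: "continuous_on {0..pi} u1" "continuous_on {0..pi} u2"
      unfolding u1_def u2_def by (intro continuous_intros contN)+
    have S0: "S (p \<theta>) \<ge> 0" for \<theta> using p_in[of \<theta>] ab by (simp add: S_def)
    have as: "2 - s \<le> a" "s - 2 \<le> a" by (simp_all add: a_def)
    show "u1 \<theta> \<ge> 0" "u2 \<theta> \<ge> 0" for \<theta>
      unfolding u1 u2 using p_in[of \<theta>] S0[of \<theta>] as ab by (auto intro!: divide_nonneg_nonneg mult_nonneg_nonneg)
    show "u1 \<theta> > 0" "u2 \<theta> > 0" if "0 < \<theta>" "\<theta> < pi" for \<theta>
      unfolding u1 u2 using p_low[of \<theta>] p_up[of \<theta>] Spos[of \<theta>] as ab that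
      by (auto intro!: divide_pos_pos mult_pos_pos)
    fix \<alpha>
    define I1 where "I1 = integral {0..pi} (\<lambda>\<theta>. 2 * N1 (p \<theta>) * exp (- (\<alpha> * p \<theta>)))"
    define I2 where "I2 = integral {0..pi} (\<lambda>\<theta>. - (N2 (p \<theta>) / 2) * exp (- (\<alpha> * p \<theta>)))"
    have E1: "E1 \<gamma> \<alpha> = of_real (I1 / pi)"
    proof -
      have "contour_integral (linepath (e2 \<gamma>) (e1 \<gamma>)) (\<lambda>x. 2 * x * exp (- of_real \<alpha> * x) / Rfun \<gamma> x) = of_real I1"
        unfolding I1_def
      proof (rule chord_integral)
        fix \<theta> assume "0 < \<theta>" "\<theta> < pi"
        then have "S (p \<theta>) \<noteq> 0" using Spos[of \<theta>] by simp
        then show "2 * of_real (p \<theta>) * exp (- of_real \<alpha> * of_real (p \<theta>))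
            = (of_real (2 * N1 (p \<theta>) * exp (- (\<alpha> * p \<theta>)) * S (p \<theta>)) :: complex)"
          by (simp add: N1_def flip: exp_of_real)
      qed (intro continuous_intros contN contp)
      then show ?thesis by (simp add: E1_def)
    qed
    have E2: "E2 \<gamma> \<alpha> = of_real (I2 / pi)"
    proof -
      have "contour_integral (linepath (e2 \<gamma>) (e1 \<gamma>))
          (\<lambda>x. (-2 - 2 * of_real \<gamma> - x\<^sup>2) * exp (- of_real \<alpha> * x) / 2 / Rfun \<gamma> x) = of_real I2"
        unfolding I2_def
      proof (rule chord_integral)
        fix \<theta> assume "0 < \<theta>" "\<theta> < pi"
        then have "S (p \<theta>) \<noteq> 0" using Spos[of \<theta>] by simp
        then have eq: "- (N2 (p \<theta>) / 2) * exp (- (\<alpha> * p \<theta>)) * S (p \<theta>)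
            = (-2 - 2 * \<gamma> - (p \<theta>)\<^sup>2) * exp (- (\<alpha> * p \<theta>)) / 2"
          by (simp add: N2_def field_simps)
        then show "(-2 - 2 * of_real \<gamma> - (of_real (p \<theta>))\<^sup>2) * exp (- of_real \<alpha> * of_real (p \<theta>)) / 2
            = (of_real (- (N2 (p \<theta>) / 2) * exp (- (\<alpha> * p \<theta>)) * S (p \<theta>)) :: complex)"
          unfolding eq by (simp flip: exp_of_real)
      qed (intro continuous_intros contN contp; simp)
      then show ?thesis by (simp add: E2_def divide_divide_eq_left)
    qed
    have int: "(\<lambda>\<theta>. 2 * N1 (p \<theta>) * exp (- (\<alpha> * p \<theta>))) integrable_on {0..pi}"
      "(\<lambda>\<theta>. - (N2 (p \<theta>) / 2) * exp (- (\<alpha> * p \<theta>))) integrable_on {0..pi}"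
      by (intro integrable_continuous_real continuous_intros contN contp; simp)+
    have "integral {0..pi} (\<lambda>\<theta>. u1 \<theta> * exp (- (\<alpha> * p \<theta>))) = 2 * (I1 + I2)"
      unfolding I1_def I2_def integral_add[OF int, symmetric] integral_mult_right[symmetric]
      by (intro integral_cong) (simp add: u1_def algebra_simps)
    moreover have "integral {0..pi} (\<lambda>\<theta>. u2 \<theta> * exp (- (\<alpha> * p \<theta>))) = 2 * (I1 - I2)"
      unfolding I1_def I2_def integral_diff[OF int, symmetric] integral_mult_right[symmetric]
      by (intro integral_cong) (simp add: u2_def algebra_simps)
    moreover have "cov \<alpha> \<gamma> = of_real ((I1 / pi)\<^sup>2 - (I2 / pi)\<^sup>2)"
      using \<gamma> by (simp add: cov_def E1 E2)
    moreover have "(I1 / pi)\<^sup>2 - (I2 / pi)\<^sup>2 = 2 * (I1 + I2) * (2 * (I1 - I2)) / (4 * pi\<^sup>2)"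
      by (simp add: field_simps power2_eq_square)
    ultimately show "cov \<alpha> \<gamma> = of_real (integral {0..pi} (\<lambda>\<theta>. u1 \<theta> * exp (- (\<alpha> * p \<theta>)))
                           * integral {0..pi} (\<lambda>\<theta>. u2 \<theta> * exp (- (\<alpha> * p \<theta>))) / (4 * pi\<^sup>2))"
      by simp
  qed (use contp p_low ab e in \<open>auto simp: p_def\<close>)
qed

text \<open>
  The two factors of the covariance share the rate \<open>p 0 = e2 \<gamma>\<close>, whence the factor 2. This rate
  vanishes exactly at \<open>\<gamma> = -1\<close>, where the reciprocal of a logarithmic rate tending to 0 from below
  gives the infinite limit.
\<close>

lemma local_corr_length_tendsto_below_1:
  assumes \<gamma>: "\<gamma> < 1"
  shows "((\<lambda>\<alpha>. ereal (local_corr_length \<gamma> \<alpha>)) \<longlongrightarrow>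
    (if \<gamma> = -1 then \<infinity> else ereal (Re (1 / (2 * e2 \<gamma>))))) at_top"
proof -
  obtain u1 u2 p :: "real \<Rightarrow> real" where
    cont: "continuous_on {0..pi} u1" "continuous_on {0..pi} u2" "continuous_on {0..pi} p" and
    nonneg: "\<And>\<theta>. \<theta> \<in> {0..pi} \<Longrightarrow> u1 \<theta> \<ge> 0" "\<And>\<theta>. \<theta> \<in> {0..pi} \<Longrightarrow> u2 \<theta> \<ge> 0" and
    pos: "\<And>\<theta>. \<lbrakk>0 < \<theta>; \<theta> < pi\<rbrakk> \<Longrightarrow> u1 \<theta> > 0" "\<And>\<theta>. \<lbrakk>0 < \<theta>; \<theta> < pi\<rbrakk> \<Longrightarrow> u2 \<theta> > 0" and
    p: "e2 \<gamma> = of_real (p 0)" "\<And>\<theta>. \<lbrakk>0 < \<theta>; \<theta> \<le> pi\<rbrakk> \<Longrightarrow> p 0 < p \<theta>" and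
    cov: "\<And>\<alpha>. cov \<alpha> \<gamma> = of_real (integral {0..pi} (\<lambda>\<theta>. u1 \<theta> * exp (- (\<alpha> * p \<theta>)))
                           * integral {0..pi} (\<lambda>\<theta>. u2 \<theta> * exp (- (\<alpha> * p \<theta>))) / (4 * pi\<^sup>2))"
    by (rule cov_below_1[OF \<gamma>]) (rule that)
  define F1 where "F1 \<alpha> = integral {0..pi} (\<lambda>\<theta>. u1 \<theta> * exp (- (\<alpha> * p \<theta>)))" for \<alpha>
  define F2 where "F2 \<alpha> = integral {0..pi} (\<lambda>\<theta>. u2 \<theta> * exp (- (\<alpha> * p \<theta>)))" for \<alpha>
  have F_pos: "F1 \<alpha> > 0" "F2 \<alpha> > 0" for \<alpha>
    unfolding F1_def F2_def using cont pos by (auto intro!: laplace_integral_pos)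
  have p_min: "p 0 \<le> p \<theta>" if "\<theta> \<in> {0..pi}" for \<theta>
    using p(2)[of \<theta>] that by (cases "\<theta> = 0") auto
  have norm_cov: "cmod (cov \<alpha> \<gamma>) = F1 \<alpha> * F2 \<alpha> / (4 * pi\<^sup>2)" for \<alpha>
    using F_pos[of \<alpha>] unfolding cov F1_def[symmetric] F2_def[symmetric] norm_of_real by simp
  have rate: "((\<lambda>\<alpha>. ln (cmod (cov \<alpha> \<gamma>)) / \<alpha>) \<longlongrightarrow> - (2 * p 0)) at_top"
  proof -
    have "((\<lambda>\<alpha>. ln (F1 \<alpha>) / \<alpha>) \<longlongrightarrow> - p 0) at_top" "((\<lambda>\<alpha>. ln (F2 \<alpha>) / \<alpha>) \<longlongrightarrow> - p 0) at_top"
      unfolding F1_def F2_def using cont nonneg pos p_min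
      by (auto intro!: ln_laplace_integral_over_tendsto)
    moreover have "((\<lambda>\<alpha>. ln (4 * pi\<^sup>2) / \<alpha>) \<longlongrightarrow> 0) at_top" by real_asymp
    ultimately have "((\<lambda>\<alpha>. ln (F1 \<alpha>) / \<alpha> + ln (F2 \<alpha>) / \<alpha> - ln (4 * pi\<^sup>2) / \<alpha>) \<longlongrightarrow> - p 0 + - p 0 - 0) at_top"
      by (intro tendsto_intros)
    moreover have "ln (cmod (cov \<alpha> \<gamma>)) / \<alpha> = ln (F1 \<alpha>) / \<alpha> + ln (F2 \<alpha>) / \<alpha> - ln (4 * pi\<^sup>2) / \<alpha>" for \<alpha>
    proof -
      have "ln (cmod (cov \<alpha> \<gamma>)) = ln (F1 \<alpha>) + ln (F2 \<alpha>) - ln (4 * pi\<^sup>2)"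
        unfolding norm_cov using F_pos[of \<alpha>] by (subst ln_div) (auto simp: ln_mult_pos)
      then show ?thesis by (simp add: add_divide_distrib diff_divide_distrib)
    qed
    ultimately show ?thesis by simp
  qed
  have "p 0 = \<bar>2 - sqrt (2 * (1 - \<gamma>))\<bar>"
    using p(1) endpoints_below_1(4)[OF \<gamma>] by (simp only: of_real_eq_iff)
  then have p0_iff: "p 0 = 0 \<longleftrightarrow> \<gamma> = -1"
    using endpoints_below_1(5)[OF \<gamma>] by linarith
  show ?thesis
  proof (cases "\<gamma> = -1")
    case False
    then have "p 0 \<noteq> 0" using p0_iff by simp
    then have "((\<lambda>\<alpha>. local_corr_length \<gamma> \<alpha>) \<longlongrightarrow> 1 / (2 * p 0)) at_top"
      unfolding local_corr_length_def using rate by (intro decay_length_tendsto) auto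
    moreover have "1 / (2 * e2 \<gamma>) = of_real (1 / (2 * p 0))" by (simp add: p(1))
    then have "Re (1 / (2 * e2 \<gamma>)) = 1 / (2 * p 0)" by (simp only: Re_complex_of_real)
    ultimately show ?thesis using False by simp
  next
    case True
    then have p0: "p 0 = 0" using p0_iff by simp
    have "(F1 \<longlongrightarrow> 0) at_top" "(F2 \<longlongrightarrow> 0) at_top"
      unfolding F1_def F2_def using cont p(2) p0 by (auto intro!: laplace_integral_tendsto_0)
    then have "((\<lambda>\<alpha>. F1 \<alpha> * F2 \<alpha> / (4 * pi\<^sup>2)) \<longlongrightarrow> 0 * 0 / (4 * pi\<^sup>2)) at_top"
      by (intro tendsto_intros) auto
    then have "filterlim (local_corr_length \<gamma>) at_top at_top"
      unfolding local_corr_length_def using rate F_pos p0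
      by (intro decay_length_at_top) (auto simp: norm_cov)
    then show ?thesis using True by (simp add: tendsto_PInfty_eq_at_top)
  qed
qed

section \<open>The covariance above the critical value\<close>

lemma integral_nonzero_if_Re_pos:
  fixes f :: "real \<Rightarrow> complex"
  assumes "a < b" "continuous_on {a..b} f" "\<And>x. \<lbrakk>a < x; x < b\<rbrakk> \<Longrightarrow> Re (f x) > 0"
  shows "integral {a..b} f \<noteq> 0"
proof -
  have "integral {a..b} (\<lambda>x. 0) < integral {a..b} (\<lambda>x. Re (f x))"
    using assms by (intro integral_less_real continuous_intros) auto
  also have "\<dots> = Re (integral {a..b} f)"
    using assms(2) by (intro integral_unique has_integral_Re integrable_integral integrable_continuous_real)
  finally show ?thesis by auto
qed

text \<open>
  On the segment \<open>P = 2 - i r cos \<theta>\<close> one has \<open>v = -(r sin \<theta>)\<^sup>2\<close>, and \<open>w = (P + 2)\<^sup>2 + r\<^sup>2\<close>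
  has positive real part, so its principal root \<open>h\<close> is continuous with positive real part, and so is
  \<open>1 / h\<close>. Since \<open>R = i r sin \<theta> h\<close>, the integrands become \<open>v / h = - f\<close> and \<open>w / h = h\<close>, which is \<open>g\<close>. The factor
  \<open>exp (-\<alpha> P)\<close> contributes \<open>exp (-2 \<alpha>)\<close> to each of the two integrals.
\<close>

lemma cov_above_1:
  assumes \<gamma>: "\<gamma> > 1"
  obtains f g :: "real \<Rightarrow> complex" and r :: real
  where "continuous_on {0..pi} f" "continuous_on {0..pi} g"
    "\<And>\<theta>. \<lbrakk>0 < \<theta>; \<theta> < pi\<rbrakk> \<Longrightarrow> Re (f \<theta>) > 0" "\<And>\<theta>. \<lbrakk>0 < \<theta>; \<theta> < pi\<rbrakk> \<Longrightarrow> Re (g \<theta>) > 0"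
    "\<And>\<alpha>. cov \<alpha> \<gamma> = - (of_real (exp (- (4 * \<alpha>)) / (4 * pi\<^sup>2))
        * integral {0..pi} (\<lambda>\<theta>. f \<theta> * exp (- (\<i> * of_real (\<alpha> * - (r * cos \<theta>)))))
        * integral {0..pi} (\<lambda>\<theta>. g \<theta> * exp (- (\<i> * of_real (\<alpha> * - (r * cos \<theta>))))))"
proof -
  define r where "r = sqrt (2 * (\<gamma> - 1))"
  have r: "r > 0" and r2: "r\<^sup>2 = 2 * (\<gamma> - 1)" using \<gamma> by (auto simp: r_def)
  define P where "P \<theta> = 2 + \<i> * of_real (- (r * cos \<theta>))" for \<theta>
  define h where "h \<theta> = csqrt ((P \<theta> + 2)\<^sup>2 + of_real (r\<^sup>2))" for \<theta>
  have e: "e1 \<gamma> = 2 + \<i> * of_real r" "e2 \<gamma> = 2 - \<i> * of_real r"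
    using e2_cnj[OF \<gamma>] by (simp_all add: r_def complex_eq_iff)
  have chord: "chord (e2 \<gamma>) (e1 \<gamma>) \<theta> = P \<theta>" for \<theta>
    by (simp add: chord_eq e P_def field_simps)
  have arg_pos: "Re ((P \<theta> + 2)\<^sup>2 + of_real (r\<^sup>2)) > 0" for \<theta>
  proof -
    have "Re ((P \<theta> + 2)\<^sup>2 + of_real (r\<^sup>2)) = 16 + r\<^sup>2 * (sin \<theta>)\<^sup>2"
      by (simp add: P_def power2_eq_square[of "_ :: complex"] sin_squared_eq power_mult_distrib algebra_simps)
         (simp add: power2_eq_square algebra_simps)
    then show ?thesis by (simp add: add_pos_nonneg)
  qed
  have arg_slit: "(P \<theta> + 2)\<^sup>2 + of_real (r\<^sup>2) \<notin> \<real>\<^sub>\<le>\<^sub>0" for \<theta>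
    using arg_pos[of \<theta>] by (auto simp: complex_nonpos_Reals_iff)
  have contP: "continuous_on X P" for X unfolding P_def by (intro continuous_intros)
  have conth: "continuous_on X h" for X
    unfolding h_def using arg_slit
    by (intro continuous_on_compose2[OF continuous_on_csqrt] continuous_intros contP) auto
  have h_pos: "Re (h \<theta>) > 0" for \<theta>
    using arg_pos[of \<theta>] add_nonneg_pos[OF norm_ge_zero arg_pos[of \<theta>]]
    unfolding h_def csqrt.sel by simp
  then have h0: "h \<theta> \<noteq> 0" for \<theta> by (metis less_irrefl zero_complex.simps(1))
  have h2: "(h \<theta>)\<^sup>2 = (P \<theta> + 2)\<^sup>2 + of_real (r\<^sup>2)" for \<theta> by (simp add: h_def)
  have R: "Rfun \<gamma> (P \<theta>) = \<i> * of_real (r * sin \<theta>) * h \<theta>" if "0 < \<theta>" "\<theta> < pi" for \<theta>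
  proof -
    have "r\<^sup>2 - (- (r * cos \<theta>))\<^sup>2 = (r * sin \<theta>)\<^sup>2"
      by (simp add: power_mult_distrib sin_squared_eq algebra_simps)
    then have "sqrt (r\<^sup>2 - (- (r * cos \<theta>))\<^sup>2) = r * sin \<theta>"
      using r sin_gt_zero[OF that] by simp
    moreover have "P \<theta> + 2 = 4 + \<i> * of_real (- (r * cos \<theta>))" by (simp add: P_def)
    ultimately show ?thesis
      using Rfun_segment[OF \<gamma>, of "- (r * cos \<theta>)", folded r_def P_def] by (simp only: h_def)
  qed
  have chord_integral: "contour_integral (linepath (e2 \<gamma>) (e1 \<gamma>)) (\<lambda>x. N x / Rfun \<gamma> x)
      = integral {0..pi} (\<lambda>\<theta>. N (P \<theta>) / h \<theta>)" if "continuous_on UNIV N" for N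
  proof (rule contour_integral_chord)
    show "continuous_on {0..pi} (\<lambda>\<theta>. N (P \<theta>) / h \<theta>)"
      using h0 by (intro continuous_intros continuous_on_compose2[OF that contP] conth) auto
    fix \<theta> assume \<theta>: "0 < \<theta>" "\<theta> < pi"
    have "sin \<theta> \<noteq> 0" using sin_gt_zero[OF \<theta>] by simp
    then show "N (chord (e2 \<gamma>) (e1 \<gamma>) \<theta>) / Rfun \<gamma> (chord (e2 \<gamma>) (e1 \<gamma>) \<theta>) * (e1 \<gamma> - e2 \<gamma>)
        * of_real (sin \<theta> / 2) = N (P \<theta>) / h \<theta>"
      unfolding chord R[OF \<theta>] unfolding e using h0[of \<theta>] r by (simp add: field_simps)
  qed
  define f where "f \<theta> = of_real ((r * sin \<theta>)\<^sup>2) / h \<theta>" for \<theta>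
  have fP: "f \<theta> = ((P \<theta> - 2)\<^sup>2 + of_real (r\<^sup>2)) / h \<theta>" for \<theta>
    by (simp add: f_def P_def power_mult_distrib sin_squared_eq algebra_simps flip: cos_of_real sin_of_real)
  have hP: "h \<theta> = ((P \<theta> + 2)\<^sup>2 + of_real (r\<^sup>2)) / h \<theta>" for \<theta>
    unfolding h2[symmetric] using h0[of \<theta>] by (simp add: power2_eq_square)
  show thesis
  proof (rule that[of f h r])
    show "continuous_on {0..pi} f" unfolding f_def using h0 by (intro continuous_intros conth) auto
    show "Re (f \<theta>) > 0" if "0 < \<theta>" "\<theta> < pi" for \<theta>
    proof -
      have "Re (f \<theta>) = (r * sin \<theta>)\<^sup>2 * Re (h \<theta>) / (cmod (h \<theta>))\<^sup>2"
        by (simp add: f_def Re_divide cmod_power2)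
      also have "\<dots> > 0"
        using r sin_gt_zero[OF that] h_pos[of \<theta>] h0[of \<theta>] by (intro divide_pos_pos mult_pos_pos) auto
      finally show ?thesis .
    qed
    fix \<alpha>
    define \<kappa> where "\<kappa> \<theta> = exp (- (\<i> * of_real (\<alpha> * - (r * cos \<theta>))))" for \<theta>
    have exp_eq: "exp (- of_real \<alpha> * P \<theta>) = of_real (exp (- (2 * \<alpha>))) * \<kappa> \<theta>" for \<theta>
      by (simp add: P_def \<kappa>_def algebra_simps flip: exp_of_real exp_add)
    define I1 where "I1 = integral {0..pi} (\<lambda>\<theta>. 2 * P \<theta> * exp (- of_real \<alpha> * P \<theta>) / h \<theta>)"
    define I2 where "I2 = integral {0..pi} (\<lambda>\<theta>. (-2 - 2 * of_real \<gamma> - (P \<theta>)\<^sup>2) * exp (- of_real \<alpha> * P \<theta>) / 2 / h \<theta>)"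
    have E1: "E1 \<gamma> \<alpha> = I1 / of_real pi"
      unfolding E1_def I1_def by (subst chord_integral) (auto intro!: continuous_intros)
    have E2: "E2 \<gamma> \<alpha> = I2 / of_real pi"
      unfolding E2_def I2_def divide_divide_eq_left[symmetric]
      by (subst chord_integral) (auto intro!: continuous_intros)
    have int: "(\<lambda>\<theta>. 2 * P \<theta> * exp (- of_real \<alpha> * P \<theta>) / h \<theta>) integrable_on {0..pi}"
      "(\<lambda>\<theta>. (-2 - 2 * of_real \<gamma> - (P \<theta>)\<^sup>2) * exp (- of_real \<alpha> * P \<theta>) / 2 / h \<theta>) integrable_on {0..pi}"
      using h0 by (intro integrable_continuous_real continuous_intros contP conth; auto)+
    have \<gamma>r: "of_real \<gamma> = (1 + (of_real r)\<^sup>2 / 2 :: complex)"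
    proof -
      have "\<gamma> = 1 + r\<^sup>2 / 2" using r2 by (simp add: field_simps)
      then have "complex_of_real \<gamma> = of_real (1 + r\<^sup>2 / 2)" by simp
      then show ?thesis by simp
    qed
    have N_plus: "4 * P \<theta> + (-2 - 2 * of_real \<gamma> - (P \<theta>)\<^sup>2) = - ((P \<theta> - 2)\<^sup>2 + of_real (r\<^sup>2))"
      and N_minus: "4 * P \<theta> - (-2 - 2 * of_real \<gamma> - (P \<theta>)\<^sup>2) = (P \<theta> + 2)\<^sup>2 + of_real (r\<^sup>2)" for \<theta>
      unfolding \<gamma>r by (simp_all add: power2_eq_square algebra_simps)
    have plus: "2 * (2 * x * e / y + N * e / 2 / y) = (4 * x + N) / y * e"
      and minus: "2 * (2 * x * e / y - N * e / 2 / y) = (4 * x - N) / y * e" for x e y N :: complex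
      by (simp_all add: add_divide_distrib diff_divide_distrib ring_distribs)
    have "2 * (I1 + I2) = - (of_real (exp (- (2 * \<alpha>))) * integral {0..pi} (\<lambda>\<theta>. f \<theta> * \<kappa> \<theta>))"
      unfolding I1_def I2_def integral_add[OF int, symmetric] integral_mult_right[symmetric] integral_neg[symmetric]
      unfolding plus N_plus exp_eq fP
      by (intro integral_cong) (simp only: minus_divide_left[symmetric] mult_minus_left mult_minus_right mult_ac)
    moreover have "2 * (I1 - I2) = of_real (exp (- (2 * \<alpha>))) * integral {0..pi} (\<lambda>\<theta>. h \<theta> * \<kappa> \<theta>)"
      unfolding I1_def I2_def integral_diff[OF int, symmetric] integral_mult_right[symmetric]
      unfolding minus N_minus exp_eq hP[symmetric]
      by (intro integral_cong) (simp only: mult_ac)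
    moreover have "cov \<alpha> \<gamma> = 2 * (I1 + I2) * (2 * (I1 - I2)) / of_real (4 * pi\<^sup>2)"
    proof -
      have "2 * (I1 + I2) * (2 * (I1 - I2)) = 4 * (I1\<^sup>2 - I2\<^sup>2)" by (simp add: power2_eq_square algebra_simps)
      then show ?thesis using \<gamma> by (simp add: cov_def E1 E2 power_divide diff_divide_distrib)
    qed
    moreover have "exp (- (4 * \<alpha>)) = exp (- (2 * \<alpha>)) * exp (- (2 * \<alpha>))" by (simp flip: exp_add)
    ultimately show "cov \<alpha> \<gamma> = - (of_real (exp (- (4 * \<alpha>)) / (4 * pi\<^sup>2))
        * integral {0..pi} (\<lambda>\<theta>. f \<theta> * exp (- (\<i> * of_real (\<alpha> * - (r * cos \<theta>)))))
        * integral {0..pi} (\<lambda>\<theta>. h \<theta> * exp (- (\<i> * of_real (\<alpha> * - (r * cos \<theta>))))))"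
      unfolding \<kappa>_def[symmetric] by simp
  qed (rule conth h_pos)+
qed

text \<open>
  The product of the two oscillating integrals is written as one integral over a square. In this form
  the decay of the product can be tested as a whole, although it does not control the two factors
  separately.
\<close>

lemma corr_length_above_1:
  assumes \<gamma>: "\<gamma> > 1"
  shows "corr_length \<gamma> = ereal (1 / 4)"
proof -
  obtain f g :: "real \<Rightarrow> complex" and r where
    cont: "continuous_on {0..pi} f" "continuous_on {0..pi} g" and
    pos: "\<And>\<theta>. \<lbrakk>0 < \<theta>; \<theta> < pi\<rbrakk> \<Longrightarrow> Re (f \<theta>) > 0" "\<And>\<theta>. \<lbrakk>0 < \<theta>; \<theta> < pi\<rbrakk> \<Longrightarrow> Re (g \<theta>) > 0" and
    cov: "\<And>\<alpha>. cov \<alpha> \<gamma> = - (of_real (exp (- (4 * \<alpha>)) / (4 * pi\<^sup>2))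
        * integral {0..pi} (\<lambda>\<theta>. f \<theta> * exp (- (\<i> * of_real (\<alpha> * - (r * cos \<theta>)))))
        * integral {0..pi} (\<lambda>\<theta>. g \<theta> * exp (- (\<i> * of_real (\<alpha> * - (r * cos \<theta>))))))"
    by (rule cov_above_1[OF \<gamma>]) (rule that)
  let ?X = "cbox (0, 0) (pi, pi) :: (real \<times> real) set"
  define \<Phi> where "\<Phi> z = f (fst z) * g (snd z)" for z
  define \<psi> where "\<psi> z = - (r * cos (fst z)) - r * cos (snd z)" for z :: "real \<times> real"
  define F where "F \<alpha> = integral ?X (\<lambda>z. \<Phi> z * exp (- (\<i> * of_real (\<alpha> * \<psi> z))))" for \<alpha>
  have cont\<Phi>: "continuous_on ?X \<Phi>" unfolding \<Phi>_def
    by (intro continuous_intros continuous_on_compose2[OF cont(1)] continuous_on_compose2[OF cont(2)])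
       (auto simp: cbox_Pair_eq)
  have cont\<psi>: "continuous_on ?X \<psi>" unfolding \<psi>_def by (intro continuous_intros)
  have F: "integral {0..pi} (\<lambda>\<theta>. f \<theta> * exp (- (\<i> * of_real (\<alpha> * - (r * cos \<theta>)))))
        * integral {0..pi} (\<lambda>\<theta>. g \<theta> * exp (- (\<i> * of_real (\<alpha> * - (r * cos \<theta>))))) = F \<alpha>" for \<alpha>
  proof -
    let ?e = "\<lambda>\<theta>. exp (- (\<i> * of_real (\<alpha> * - (r * cos \<theta>))))"
    have "integral ?X (\<lambda>z. (f (fst z) * ?e (fst z)) * (g (snd z) * ?e (snd z)))
        = integral (cbox 0 pi) (\<lambda>\<theta>. f \<theta> * ?e \<theta>) * integral (cbox 0 pi) (\<lambda>\<theta>. g \<theta> * ?e \<theta>)"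
      using cont by (intro integral_times_integral continuous_intros) auto
    moreover have "(f (fst z) * ?e (fst z)) * (g (snd z) * ?e (snd z))
        = \<Phi> z * exp (- (\<i> * of_real (\<alpha> * \<psi> z)))" for z
      by (simp add: \<Phi>_def \<psi>_def algebra_simps flip: exp_add)
    ultimately show ?thesis by (simp add: F_def)
  qed
  have cov: "cmod (cov \<alpha> \<gamma>) = exp (- (4 * \<alpha>)) / (4 * pi\<^sup>2) * cmod (F \<alpha>)" for \<alpha>
    unfolding cov mult.assoc F by (simp add: norm_mult norm_divide norm_power)
  have "integral ?X \<Phi> = integral (cbox 0 pi) f * integral (cbox 0 pi) g"
    unfolding \<Phi>_def using cont by (intro integral_times_integral) auto
  then have \<Phi>0: "integral ?X \<Phi> \<noteq> 0"
    using integral_nonzero_if_Re_pos[OF pi_gt_zero cont(1) pos(1)]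
      integral_nonzero_if_Re_pos[OF pi_gt_zero cont(2) pos(2)] by simp
  obtain M where M: "\<And>z. z \<in> ?X \<Longrightarrow> cmod (\<Phi> z) \<le> M" "M > 0"
    using compact_imp_bounded[OF compact_continuous_image[OF cont\<Phi> compact_cbox]]
    unfolding bounded_pos by auto
  have Fbound: "cmod (F \<alpha>) \<le> M * measure lborel ?X" for \<alpha>
    unfolding F_def
    by (intro integrable_bound integrable_continuous continuous_intros cont\<Phi> cont\<psi>)
       (use M in \<open>auto simp: norm_mult norm_exp_eq_Re\<close>)
  have "measure lborel ?X = pi * pi" by (simp add: content_Pair)
  with M have K: "M * measure lborel ?X / (4 * pi\<^sup>2) > 0" by simp
  show ?thesis
    unfolding corr_length_def local_corr_length_def
  proof (rule Limsup_decay_length[OF _ K])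
    show "cmod (cov \<alpha> \<gamma>) \<le> M * measure lborel ?X / (4 * pi\<^sup>2) * exp (- (4 * \<alpha>))" for \<alpha>
      unfolding cov using Fbound[of \<alpha>] by (simp add: divide_right_mono mult_left_mono mult.commute)
    fix \<epsilon> :: real assume \<epsilon>: "\<epsilon> > 0"
    show "\<not> (\<forall>\<^sub>F \<alpha> in at_top. cmod (cov \<alpha> \<gamma>) \<le> exp (- ((4 + \<epsilon>) * \<alpha>)))"
    proof
      assume "\<forall>\<^sub>F \<alpha> in at_top. cmod (cov \<alpha> \<gamma>) \<le> exp (- ((4 + \<epsilon>) * \<alpha>))"
      then have "\<forall>\<^sub>F \<alpha> in at_top. cmod (F \<alpha>) \<le> 4 * pi\<^sup>2 * exp (- (\<epsilon> * \<alpha>))"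
      proof eventually_elim
        case (elim \<alpha>)
        have "exp (- ((4 + \<epsilon>) * \<alpha>)) = exp (- (4 * \<alpha>)) * exp (- (\<epsilon> * \<alpha>))"
          by (simp add: algebra_simps flip: exp_add)
        then have "exp (- (4 * \<alpha>)) * (cmod (F \<alpha>) / (4 * pi\<^sup>2)) \<le> exp (- (4 * \<alpha>)) * exp (- (\<epsilon> * \<alpha>))"
          using elim unfolding cov by simp
        then have "cmod (F \<alpha>) / (4 * pi\<^sup>2) \<le> exp (- (\<epsilon> * \<alpha>))" by (simp only: mult_le_cancel_left_pos exp_gt_zero)
        then show ?case by (simp add: divide_le_eq mult.commute)
      qed
      then have "integral ?X \<Phi> = 0"
        unfolding F_def by (rule integral_eq_0_if_fourier_decay[OF cont\<Phi> cont\<psi> \<epsilon>])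
      with \<Phi>0 show False by simp
    qed
  qed auto
qed

section \<open>The correlation length\<close>

theorem lemma1p6:
  fixes \<gamma> :: real
  shows "corr_length \<gamma> =
           (if \<gamma> < -1 then ereal (Re (1 / (2 * e2 \<gamma>)))
            else if \<gamma> = -1 then \<infinity>
            else if \<gamma> < 1 then ereal (Re (1 / (2 * e2 \<gamma>)))
            else if \<gamma> = 1 then 0
            else ereal (1 / 4))
         \<and> (\<gamma> \<le> 1 \<longrightarrow> ((\<lambda>\<alpha>. ereal (local_corr_length \<gamma> \<alpha>)) \<longlongrightarrow> corr_length \<gamma>) at_top)"
proof -
  have lim: "corr_length \<gamma> = l \<and> ((\<lambda>\<alpha>. ereal (local_corr_length \<gamma> \<alpha>)) \<longlongrightarrow> corr_length \<gamma>) at_top"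
    if "((\<lambda>\<alpha>. ereal (local_corr_length \<gamma> \<alpha>)) \<longlongrightarrow> l) at_top" for l
    using that lim_imp_Limsup[OF _ that] by (simp add: corr_length_def)
  consider "\<gamma> < 1" | "\<gamma> = 1" | "\<gamma> > 1" by linarith
  then show ?thesis
  proof cases
    case 1
    then show ?thesis using lim[OF local_corr_length_tendsto_below_1[OF 1]] by auto
  next
    case 2
    then have "local_corr_length \<gamma> = (\<lambda>\<alpha>. 0)" by (simp add: fun_eq_iff local_corr_length_def cov_def)
    then show ?thesis using lim[of 0] 2 by (simp add: zero_ereal_def)
  next
    case 3
    then show ?thesis using corr_length_above_1[OF 3] by simp
  qed
qed

end
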